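(* Let $V$ be an irreducible integrable $\tau(B)$-module with finite dimensional weight spaces with respect to $H$, such that $K_0$ acts on $V$ by a positive integer $c_0$ and $K_i$ acts trivially on $V$ for $1\le i\le n$. Then $K_i\otimes b$ acts trivially on $V$ for all $1\le i\le n$ and all $b\in B$.
   Context: Everything is over $\mathbb C$. $\dot{\mathfrak g}$ is a finite dimensional simple Lie algebra with Cartan subalgebra $\dot{\mathfrak h}$, root system $\dot\Delta$, and normalized invariant non-degenerate symmetric bilinear form $(\cdot,\cdot)$. $n\ge 1$ is an integer and $B$ is a commutative associative finitely generated unital $\mathbb C$-algebra. $A=\mathbb C[t_0^{\pm1},\dots,t_n^{\pm1}]$, $t^{\underline m}=t_1^{m_1}\cdots t_n^{m_n}$ for $\underline m\in\mathbb Z^n$. $\Omega_A$ is the vector space with basis $t_0^{k_0}t^{\underline k}K_i$ ($0\le i\le n$, $k_0\in\mathbb Z$, $\underline k\in\mathbb Z^n$), $dA$ is the span of the elements $\sum_{i=0}^n k_i t_0^{k_0}t^{\underline k}K_i$, and $Z=\Omega_A/dA$. $\tau_0=\dot{\mathfrak g}\otimes A\oplus Z$ with $Z$ central and $[x\otimes t_0^{k_0}t^{\underline k},y\otimes t_0^{r_0}t^{\underline r}]=[x,y]\otimes t_0^{k_0+r_0}t^{\underline k+\underline r}+(x,y)\sum_{i=0}^n k_i t_0^{k_0+r_0}t^{\underline k+\underline r}K_i$. $\tau(B)=\tau_0\otimes B\oplus D$, $D=\mathrm{span}\{d_0,\dots,d_n\}$, with $[x\otimes b,y\otimes b']=[x,y]\otimes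 bb'$, $[d_i,x\otimes t_0^{k_0}t^{\underline k}\otimes b]=k_i\,x\otimes t_0^{k_0}t^{\underline k}\otimes b$, $[d_i,t_0^{k_0}t^{\underline k}K_j\otimes b]=k_i\,t_0^{k_0}t^{\underline k}K_j\otimes b$, $[d_i,d_j]=0$. $K_i$ and $\dot{\mathfrak h}$ are identified with $K_i\otimes 1$ and $\dot{\mathfrak h}\otimes1\otimes1$; $H=\dot{\mathfrak h}\oplus\bigoplus_i\mathbb CK_i\oplus\bigoplus_i\mathbb Cd_i$. A $\tau(B)$-module $V$ is integrable if $V=\bigoplus_{\lambda\in H^*}V_\lambda$ with $V_\lambda=\{v:hv=\lambda(h)v\ \forall h\in H\}$ (weight spaces), and for all $\alpha\in\dot\Delta$, $(m_0,\underline m)\in\mathbb Z^{n+1}$, $b\in B$, $v\in V$ there is $k$ with $(X_\alpha\otimes t_0^{m_0}t^{\underline m}\otimes b)^k v=0$, where $X_\alpha$ is a root vector of root $\alpha$. *)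

theory Defs
  imports "HOL-Analysis.Finite_Cartesian_Product" "HOL-Analysis.Product_Vector" "HOL-Library.Poly_Mapping"
begin

section \<open>Complex vector spaces\<close>

class complex_vector = ab_group_add +
  fixes scaleC :: "complex \<Rightarrow> 'a \<Rightarrow> 'a" (infixr \<open>*\<^sub>C\<close> 75)
  assumes scaleC_add_right: "a *\<^sub>C (x + y) = a *\<^sub>C x + a *\<^sub>C y"
    and scaleC_add_left: "(a + b) *\<^sub>C x = a *\<^sub>C x + b *\<^sub>C x"
    and scaleC_scaleC: "a *\<^sub>C b *\<^sub>C x = (a * b) *\<^sub>C x"
    and scaleC_one: "1 *\<^sub>C x = x"

global_interpretation complex_vector: vector_space "scaleC :: complex \<Rightarrow> 'a \<Rightarrow> 'a::complex_vector"
  by unfold_locales (fact scaleC_add_right scaleC_add_left scaleC_scaleC scaleC_one)+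

abbreviation clinear :: "('a::complex_vector \<Rightarrow> 'b::complex_vector) \<Rightarrow> bool"
  where "clinear \<equiv> Vector_Spaces.linear scaleC scaleC"

definition cbilinear :: "('a::complex_vector \<Rightarrow> 'b::complex_vector \<Rightarrow> 'c::complex_vector) \<Rightarrow> bool"
  where "cbilinear f \<longleftrightarrow> (\<forall>x. clinear (f x)) \<and> (\<forall>y. clinear (\<lambda>x. f x y))"

definition finite_dimensional :: "'a::complex_vector set \<Rightarrow> bool"
  where "finite_dimensional W \<longleftrightarrow> (\<exists>S. finite S \<and> complex_vector.span S = W)"

text \<open>The dual of a subspace \<open>H\<close>; functionals are represented by functions vanishing outside \<open>H\<close>,
  so that each functional on \<open>H\<close> has exactly one representative.\<close>

definition dual :: "'a::complex_vector set \<Rightarrow> ('a \<Rightarrow> complex) set"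
  where "dual H = {f. (\<forall>x\<in>H. \<forall>y\<in>H. f (x + y) = f x + f y) \<and> (\<forall>c. \<forall>x\<in>H. f (c *\<^sub>C x) = c * f x) \<and>
     (\<forall>x. x \<notin> H \<longrightarrow> f x = 0)}"

text \<open>The whole space is the direct sum of the family \<open>W i\<close>, \<open>i \<in> I\<close>.\<close>

definition is_direct_sum :: "'i set \<Rightarrow> ('i \<Rightarrow> 'v::complex_vector set) \<Rightarrow> bool"
  where "is_direct_sum I W \<longleftrightarrow> (\<forall>i\<in>I. complex_vector.subspace (W i)) \<and>
    (\<forall>v. \<exists>!f. (\<forall>i\<in>I. f i \<in> W i) \<and> (\<forall>i. i \<notin> I \<longrightarrow> f i = 0) \<and>
       finite {i. f i \<noteq> 0} \<and> v = (\<Sum>i\<in>{i. f i \<noteq> 0}. f i))"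

lemma clinearI:
  "(\<And>x y. f (x + y) = f x + f y) \<Longrightarrow> (\<And>c x. f (c *\<^sub>C x) = c *\<^sub>C f x) \<Longrightarrow> clinear f"
  by (simp add: Vector_Spaces.linear_iff complex_vector.vector_space_axioms)

lemma clinear_add: "clinear f \<Longrightarrow> f (x + y) = f x + f y"
  and clinear_scale: "clinear f \<Longrightarrow> f (c *\<^sub>C x) = c *\<^sub>C f x"
  unfolding Vector_Spaces.linear_iff by blast+

lemma clinear_0: "clinear f \<Longrightarrow> f 0 = 0"
  using clinear_scale[of f 0 0] by simp

lemma clinear_diff: "clinear f \<Longrightarrow> f (x - y) = f x - f y"
  using clinear_add[of f "x - y" y] by simp

lemma clinear_sum: "clinear f \<Longrightarrow> f (sum g A) = (\<Sum>x\<in>A. f (g x))"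
  by (induction A rule: infinite_finite_induct) (auto simp: clinear_0 clinear_add)

lemma clinear_compose: "clinear f \<Longrightarrow> clinear g \<Longrightarrow> clinear (\<lambda>x. f (g x))"
  by (intro clinearI) (simp_all add: clinear_add clinear_scale)

lemma cbilinearD: "cbilinear f \<Longrightarrow> clinear (f x)" "cbilinear f \<Longrightarrow> clinear (\<lambda>x. f x y)"
  by (auto simp: cbilinear_def)

instantiation complex :: complex_vector
begin
definition "scaleC_complex (a::complex) (x::complex) = a * x"
instance by standard (simp_all add: scaleC_complex_def algebra_simps)
end

instantiation prod :: (complex_vector, complex_vector) complex_vector
begin
definition "scaleC_prod a x = (a *\<^sub>C fst x, a *\<^sub>C snd x)"
instance by standard
  (simp_all add: scaleC_prod_def scaleC_add_right scaleC_add_left scaleC_one plus_prod_def)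
end

instantiation vec :: (complex_vector, finite) complex_vector
begin
definition "scaleC_vec a x = (\<chi> i. a *\<^sub>C x $ i)"
instance by standard
  (simp_all add: scaleC_vec_def vec_eq_iff scaleC_add_right scaleC_add_left scaleC_one)
end

instantiation poly_mapping :: (type, complex_vector) complex_vector
begin
definition "scaleC_poly_mapping a p = Poly_Mapping.map (\<lambda>x. a *\<^sub>C x) p"
lemma lookup_scaleC:
  "Poly_Mapping.lookup (a *\<^sub>C p) k = a *\<^sub>C Poly_Mapping.lookup p k" for p :: "('a, 'b) poly_mapping"
  by (simp add: scaleC_poly_mapping_def map.rep_eq when_def)
instance by standard
  (simp_all add: poly_mapping_eq_iff fun_eq_iff lookup_scaleC lookup_add
     scaleC_add_right scaleC_add_left scaleC_one)
end

text \<open>Linear extension of a function on the basis \<open>Poly_Mapping.single u 1\<close>.\<close>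

definition lin_ext :: "('u \<Rightarrow> 'c::complex_vector) \<Rightarrow> ('u \<Rightarrow>\<^sub>0 complex) \<Rightarrow> 'c"
  where "lin_ext f p = (\<Sum>u\<in>Poly_Mapping.keys p. Poly_Mapping.lookup p u *\<^sub>C f u)"

lemma lin_ext_superset:
  assumes "finite S" "Poly_Mapping.keys p \<subseteq> S"
  shows "lin_ext f p = (\<Sum>u\<in>S. Poly_Mapping.lookup p u *\<^sub>C f u)"
  unfolding lin_ext_def
  by (rule sum.mono_neutral_left) (use assms in \<open>auto simp: in_keys_iff\<close>)

lemma clinear_lin_ext: "clinear (lin_ext f)"
proof (rule clinearI)
  fix p q :: "'a \<Rightarrow>\<^sub>0 complex"
  let ?S = "Poly_Mapping.keys p \<union> Poly_Mapping.keys q"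
  have "lin_ext f (p + q) = (\<Sum>u\<in>?S. Poly_Mapping.lookup (p + q) u *\<^sub>C f u)"
    by (rule lin_ext_superset) (use Poly_Mapping.keys_add[of p q] in auto)
  also have "\<dots> = (\<Sum>u\<in>?S. Poly_Mapping.lookup p u *\<^sub>C f u) + (\<Sum>u\<in>?S. Poly_Mapping.lookup q u *\<^sub>C f u)"
    by (simp add: lookup_add scaleC_add_left sum.distrib)
  also have "\<dots> = lin_ext f p + lin_ext f q"
    by (subst (1 2) lin_ext_superset[of ?S]) auto
  finally show "lin_ext f (p + q) = lin_ext f p + lin_ext f q" .
next
  fix c and p :: "'a \<Rightarrow>\<^sub>0 complex"
  have "lin_ext f (c *\<^sub>C p) = (\<Sum>u\<in>Poly_Mapping.keys p. Poly_Mapping.lookup (c *\<^sub>C p) u *\<^sub>C f u)"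
    by (rule lin_ext_superset) (auto simp: in_keys_iff lookup_scaleC)
  then show "lin_ext f (c *\<^sub>C p) = c *\<^sub>C lin_ext f p"
    by (simp add: lin_ext_def lookup_scaleC scaleC_complex_def complex_vector.scale_sum_right)
qed

lemma lin_ext_single [simp]: "lin_ext f (Poly_Mapping.single u c) = c *\<^sub>C f u"
  by (subst lin_ext_superset[of "{u}"]) auto

lemma clinear_lin_ext_fun:
  assumes "\<And>u. clinear (\<lambda>x. f x u)"
  shows "clinear (\<lambda>x. lin_ext (f x) p)"
  unfolding lin_ext_def
  by (rule clinearI)
     (simp_all add: clinear_add[OF assms] clinear_scale[OF assms] scaleC_add_right sum.distrib
        complex_vector.scale_sum_right mult.commute)

lemma single_scaleC: "Poly_Mapping.single u c = c *\<^sub>C Poly_Mapping.single u (1::complex)"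
  by (rule poly_mapping_eqI) (simp add: lookup_scaleC lookup_single scaleC_complex_def when_def)

lemma lin_ext_basis: "lin_ext (\<lambda>u. Poly_Mapping.single u 1) p = p"
proof (rule poly_mapping_eqI)
  fix k
  have cl: "clinear (\<lambda>p::'a \<Rightarrow>\<^sub>0 complex. Poly_Mapping.lookup p k)"
    by (rule clinearI) (simp_all add: lookup_add lookup_scaleC)
  have "Poly_Mapping.lookup (lin_ext (\<lambda>u. Poly_Mapping.single u 1) p) k =
      (\<Sum>u\<in>Poly_Mapping.keys p. if u = k then Poly_Mapping.lookup p u else 0)"
    unfolding lin_ext_def clinear_sum[OF cl]
    by (intro sum.cong) (simp_all add: lookup_scaleC lookup_single scaleC_complex_def when_def)
  then show "Poly_Mapping.lookup (lin_ext (\<lambda>u. Poly_Mapping.single u 1) p) k = Poly_Mapping.lookup p k"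
    by (simp add: in_keys_iff)
qed

lemma clinear_eq_basis:
  fixes f g :: "('u \<Rightarrow>\<^sub>0 complex) \<Rightarrow> 'c::complex_vector"
  assumes "clinear f" "clinear g" "\<And>u. f (Poly_Mapping.single u 1) = g (Poly_Mapping.single u 1)"
  shows "f p = g p"
proof -
  have "f (lin_ext (\<lambda>u. Poly_Mapping.single u 1) p) = g (lin_ext (\<lambda>u. Poly_Mapping.single u 1) p)"
    unfolding lin_ext_def clinear_sum[OF assms(1)] clinear_sum[OF assms(2)]
    by (simp add: clinear_scale[OF assms(1)] clinear_scale[OF assms(2)] assms(3))
  then show ?thesis by (simp add: lin_ext_basis)
qed

lemma equivp_mod_subspace:
  "complex_vector.subspace S \<Longrightarrow> equivp (\<lambda>x y. x - y \<in> S)"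
proof (rule equivpI)
  assume S: "complex_vector.subspace S"
  show "reflp (\<lambda>x y. x - y \<in> S)"
    by (rule reflpI) (simp add: complex_vector.subspace_0[OF S])
  show "symp (\<lambda>x y. x - y \<in> S)"
    by (rule sympI) (use complex_vector.subspace_neg[OF S] in fastforce)
  show "transp (\<lambda>x y. x - y \<in> S)"
    by (rule transpI) (use complex_vector.subspace_add[OF S] in fastforce)
qed

section \<open>Tensor products over the complex numbers\<close>

definition tensor_relations :: "('a::complex_vector \<times> 'b::complex_vector \<Rightarrow>\<^sub>0 complex) set"
  where "tensor_relations = complex_vector.span (
     {Poly_Mapping.single (x + x', y) 1 - Poly_Mapping.single (x, y) 1 - Poly_Mapping.single (x', y) 1 | x x' y. True} \<union>
     {Poly_Mapping.single (x, y + y') 1 - Poly_Mapping.single (x, y) 1 - Poly_Mapping.single (x, y') 1 | x y y'. True} \<union>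
     {Poly_Mapping.single (c *\<^sub>C x, y) 1 - c *\<^sub>C Poly_Mapping.single (x, y) 1 | c x y. True} \<union>
     {Poly_Mapping.single (x, c *\<^sub>C y) 1 - c *\<^sub>C Poly_Mapping.single (x, y) 1 | c x y. True})"

lemma subspace_tensor_relations: "complex_vector.subspace tensor_relations"
  by (simp add: tensor_relations_def)

quotient_type (overloaded) ('a, 'b) tensor (infixl \<open>\<otimes>\<^sub>C\<close> 70) =
    "('a::complex_vector \<times> 'b::complex_vector) \<Rightarrow>\<^sub>0 complex" / "\<lambda>p q. p - q \<in> tensor_relations"
  by (rule equivp_mod_subspace[OF subspace_tensor_relations])

instantiation tensor :: (complex_vector, complex_vector) complex_vector
begin
lift_definition zero_tensor :: "('a, 'b) tensor" is 0 .
lift_definition plus_tensor :: "('a, 'b) tensor \<Rightarrow> ('a, 'b) tensor \<Rightarrow> ('a, 'b) tensor" is "(+)"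
proof -
  fix p q r s :: "('a \<times> 'b) \<Rightarrow>\<^sub>0 complex"
  assume "p - q \<in> tensor_relations" "r - s \<in> tensor_relations"
  from complex_vector.subspace_add[OF subspace_tensor_relations this]
  show "p + r - (q + s) \<in> tensor_relations" by (simp add: algebra_simps)
qed
lift_definition minus_tensor :: "('a, 'b) tensor \<Rightarrow> ('a, 'b) tensor \<Rightarrow> ('a, 'b) tensor" is "(-)"
proof -
  fix p q r s :: "('a \<times> 'b) \<Rightarrow>\<^sub>0 complex"
  assume "p - q \<in> tensor_relations" "r - s \<in> tensor_relations"
  from complex_vector.subspace_diff[OF subspace_tensor_relations this]
  show "p - r - (q - s) \<in> tensor_relations" by (simp add: algebra_simps)
qed
lift_definition uminus_tensor :: "('a, 'b) tensor \<Rightarrow> ('a, 'b) tensor" is uminus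
proof -
  fix p q :: "('a \<times> 'b) \<Rightarrow>\<^sub>0 complex"
  assume "p - q \<in> tensor_relations"
  from complex_vector.subspace_neg[OF subspace_tensor_relations this]
  show "- p - - q \<in> tensor_relations" by simp
qed
lift_definition scaleC_tensor :: "complex \<Rightarrow> ('a, 'b) tensor \<Rightarrow> ('a, 'b) tensor" is scaleC
proof -
  fix c and p q :: "('a \<times> 'b) \<Rightarrow>\<^sub>0 complex"
  assume "p - q \<in> tensor_relations"
  from complex_vector.subspace_scale[OF subspace_tensor_relations this, of c]
  show "c *\<^sub>C p - c *\<^sub>C q \<in> tensor_relations" by (simp add: complex_vector.scale_right_diff_distrib)
qed
instance
  by standard (transfer; simp add: algebra_simps
    complex_vector.subspace_0[OF subspace_tensor_relations])+
end

lift_definition pure_tensor :: "'a::complex_vector \<Rightarrow> 'b::complex_vector \<Rightarrow> ('a, 'b) tensor" (infixl \<open>\<otimes>\<close> 70)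
  is "\<lambda>x y. Poly_Mapping.single (x, y) 1" .

text \<open>The universal property: the linear map on the tensor product induced by a bilinear map.\<close>

definition tensor_lift :: "('a::complex_vector \<Rightarrow> 'b::complex_vector \<Rightarrow> 'c::complex_vector) \<Rightarrow> ('a, 'b) tensor \<Rightarrow> 'c"
  where "tensor_lift f = (THE g. clinear g \<and> (\<forall>x y. g (x \<otimes> y) = f x y))"

lemma tensor_relations_mem:
  "Poly_Mapping.single (x + x', y) 1 - (Poly_Mapping.single (x, y) 1 + Poly_Mapping.single (x', y) 1) \<in> tensor_relations"
  "Poly_Mapping.single (x, y + y') 1 - (Poly_Mapping.single (x, y) 1 + Poly_Mapping.single (x, y') 1) \<in> tensor_relations"
  "Poly_Mapping.single (c *\<^sub>C x, y) 1 - c *\<^sub>C Poly_Mapping.single (x, y) 1 \<in> tensor_relations"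
  "Poly_Mapping.single (x, c *\<^sub>C y) 1 - c *\<^sub>C Poly_Mapping.single (x, y) 1 \<in> tensor_relations"
  unfolding tensor_relations_def diff_diff_eq[symmetric]
  by (rule complex_vector.span_base, rule UnI1, rule UnI1, rule UnI1, rule CollectI,
        rule exI[of _ x], rule exI[of _ x'], rule exI[of _ y], simp)
     (rule complex_vector.span_base, rule UnI1, rule UnI1, rule UnI2, rule CollectI,
        rule exI[of _ x], rule exI[of _ y], rule exI[of _ y'], simp,
      rule complex_vector.span_base, rule UnI1, rule UnI2, rule CollectI,
        rule exI[of _ c], rule exI[of _ x], rule exI[of _ y], simp,
      rule complex_vector.span_base, rule UnI2, rule CollectI,
        rule exI[of _ c], rule exI[of _ x], rule exI[of _ y], simp)

lemma cbilinear_tensor: "cbilinear (\<otimes>)"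
  unfolding cbilinear_def
  by (intro conjI allI clinearI; unfold pure_tensor.abs_eq plus_tensor.abs_eq scaleC_tensor.abs_eq
      tensor.abs_eq_iff; rule tensor_relations_mem)

lemma clinear_abs_tensor: "clinear abs_tensor"
  by (rule clinearI) (simp_all add: plus_tensor.abs_eq scaleC_tensor.abs_eq)

lemma clinear_eq_pure:
  fixes f g :: "('a::complex_vector, 'b::complex_vector) tensor \<Rightarrow> 'c::complex_vector"
  assumes "clinear f" "clinear g" "\<And>x y. f (x \<otimes> y) = g (x \<otimes> y)"
  shows "f t = g t"
proof -
  have "f (abs_tensor p) = g (abs_tensor p)" for p
    by (rule clinear_eq_basis[OF clinear_compose[OF assms(1) clinear_abs_tensor]
          clinear_compose[OF assms(2) clinear_abs_tensor]])
       (use assms(3) in \<open>auto simp: pure_tensor_def\<close>)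
  then show ?thesis by (induction t rule: tensor.abs_induct) simp
qed

lemma tensor_lift_ex1:
  fixes f :: "'a::complex_vector \<Rightarrow> 'b::complex_vector \<Rightarrow> 'c::complex_vector"
  assumes f: "cbilinear f"
  shows "\<exists>!g. clinear g \<and> (\<forall>x y. g (x \<otimes> y) = f x y)"
proof (rule ex_ex1I)
  define F where "F = lin_ext (\<lambda>(x, y). f x y)"
  have F: "clinear F" unfolding F_def by (rule clinear_lin_ext)
  have Fs: "F (Poly_Mapping.single (x, y) 1) = f x y" for x y
    by (simp add: F_def)
  note add1 = clinear_add[OF cbilinearD(2)[OF f]] and add2 = clinear_add[OF cbilinearD(1)[OF f]]
    and scale1 = clinear_scale[OF cbilinearD(2)[OF f]] and scale2 = clinear_scale[OF cbilinearD(1)[OF f]]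
  have "F r = 0" if "r \<in> tensor_relations" for r
    using that unfolding tensor_relations_def
  proof (induction rule: complex_vector.span_induct)
    case base
    show ?case
      by (auto simp: complex_vector.subspace_def clinear_0[OF F] clinear_add[OF F] clinear_scale[OF F])
  next
    case (step r)
    then consider
        x x' y where "r = Poly_Mapping.single (x + x', y) 1 - Poly_Mapping.single (x, y) 1 - Poly_Mapping.single (x', y) 1"
      | x y y' where "r = Poly_Mapping.single (x, y + y') 1 - Poly_Mapping.single (x, y) 1 - Poly_Mapping.single (x, y') 1"
      | c x y where "r = Poly_Mapping.single (c *\<^sub>C x, y) 1 - c *\<^sub>C Poly_Mapping.single (x, y) 1"
      | c x y where "r = Poly_Mapping.single (x, c *\<^sub>C y) 1 - c *\<^sub>C Poly_Mapping.single (x, y) 1"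
      by blast
    then show ?case
      by cases (simp_all only: clinear_diff[OF F] clinear_scale[OF F] Fs add1 add2 scale1 scale2
        diff_self add_diff_cancel_left')
  qed
  then have F_rel: "F p = F q" if "p - q \<in> tensor_relations" for p q
    using that clinear_diff[OF F, of p q] by simp
  define G where "G t = F (rep_tensor t)" for t
  have G: "G (abs_tensor p) = F p" for p
    unfolding G_def
    by (rule F_rel, unfold tensor.abs_eq_iff[symmetric] Quotient3_abs_rep[OF Quotient3_tensor], rule refl)
  have "clinear G"
  proof (rule clinearI)
    show "G (s + t) = G s + G t" for s t
      by (induction s rule: tensor.abs_induct, induction t rule: tensor.abs_induct) (simp add: plus_tensor.abs_eq G clinear_add[OF F])
    show "G (c *\<^sub>C t) = c *\<^sub>C G t" for c t
      by (induction t rule: tensor.abs_induct) (simp add: scaleC_tensor.abs_eq G clinear_scale[OF F])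
  qed
  moreover have "G (x \<otimes> y) = f x y" for x y
    by (simp add: pure_tensor.abs_eq G Fs)
  ultimately show "\<exists>g. clinear g \<and> (\<forall>x y. g (x \<otimes> y) = f x y)"
    by (intro exI[of _ G] conjI allI)
next
  fix g g' assume "clinear g \<and> (\<forall>x y. g (x \<otimes> y) = f x y)" "clinear g' \<and> (\<forall>x y. g' (x \<otimes> y) = f x y)"
  then show "g = g'" by (intro ext, rule_tac clinear_eq_pure[of g g']) simp_all
qed

lemma tensor_lift:
  assumes "cbilinear f"
  shows clinear_tensor_lift: "clinear (tensor_lift f)"
    and tensor_lift_pure: "tensor_lift f (x \<otimes> y) = f x y"
  using theI'[OF tensor_lift_ex1[OF assms], folded tensor_lift_def] by blast+

lemma clinear_eq_pure2:
  assumes "cbilinear F" "cbilinear G"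
    and "\<And>x y x' y'. F (x \<otimes> y) (x' \<otimes> y') = G (x \<otimes> y) (x' \<otimes> y')"
  shows "F s t = G s t"
proof (rule clinear_eq_pure[of "F s" "G s"])
  show "clinear (F s)" "clinear (G s)" using assms by (auto simp: cbilinear_def)
  fix x' y'
  show "F s (x' \<otimes> y') = G s (x' \<otimes> y')"
    by (rule clinear_eq_pure[of "\<lambda>s. F s (x' \<otimes> y')"]) (use assms in \<open>auto simp: cbilinear_def\<close>)
qed

definition tensor_lift2 ::
  "('a::complex_vector \<Rightarrow> 'b::complex_vector \<Rightarrow> 'c::complex_vector \<Rightarrow> 'd::complex_vector \<Rightarrow> 'e::complex_vector)
     \<Rightarrow> ('a, 'b) tensor \<Rightarrow> ('c, 'd) tensor \<Rightarrow> 'e"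
  where "tensor_lift2 f s t = tensor_lift (\<lambda>x y. tensor_lift (\<lambda>x' y'. f x y x' y') t) s"

definition quadrilinear ::
  "('a::complex_vector \<Rightarrow> 'b::complex_vector \<Rightarrow> 'c::complex_vector \<Rightarrow> 'd::complex_vector \<Rightarrow> 'e::complex_vector) \<Rightarrow> bool"
  where "quadrilinear f \<longleftrightarrow> (\<forall>x y. cbilinear (f x y)) \<and> (\<forall>x' y'. cbilinear (\<lambda>x y. f x y x' y'))"

lemma cbilinear_lift_inner:
  assumes f: "quadrilinear f"
  shows "cbilinear (\<lambda>x y. tensor_lift (f x y) t)"
proof -
  have 1: "cbilinear (f x y)" for x y using f by (simp add: quadrilinear_def)
  have 2: "clinear (\<lambda>x. f x y x' y')" "clinear (\<lambda>y. f x y x' y')" for x y x' y'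
    using f by (auto simp: quadrilinear_def cbilinear_def)
  note l = clinear_tensor_lift[OF 1] 
  have add: "clinear (\<lambda>t. tensor_lift (f x y) t + tensor_lift (f x' y') t)" for x y x' y'
    by (rule clinearI) (simp_all add: clinear_add[OF l] clinear_scale[OF l] scaleC_add_right algebra_simps)
  have scale: "clinear (\<lambda>t. c *\<^sub>C tensor_lift (f x y) t)" for c x y
    by (rule clinearI) (simp_all add: clinear_add[OF l] clinear_scale[OF l] scaleC_add_right
        scaleC_scaleC mult.commute)
  show ?thesis unfolding cbilinear_def
    by (intro conjI allI clinearI; rule clinear_eq_pure[OF l add] clinear_eq_pure[OF l scale])
       (simp_all add: tensor_lift_pure[OF 1] clinear_add[OF 2(1)] clinear_add[OF 2(2)]
          clinear_scale[OF 2(1)] clinear_scale[OF 2(2)])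
qed

lemma tensor_lift2_pure:
  assumes f: "quadrilinear f"
  shows "tensor_lift2 f (x \<otimes> y) (x' \<otimes> y') = f x y x' y'"
proof -
  have "cbilinear (f x y)" for x y using f by (simp add: quadrilinear_def)
  moreover have "cbilinear (\<lambda>x y. f x y x' y')" for x' y' using f by (simp add: quadrilinear_def)
  ultimately show ?thesis
    by (simp add: tensor_lift2_def tensor_lift_pure cbilinear_lift_inner[OF f])
qed

lemma cbilinear_tensor_lift2:
  assumes f: "quadrilinear f"
  shows "cbilinear (tensor_lift2 f)"
proof -
  have 1: "cbilinear (f x y)" for x y using f by (simp add: quadrilinear_def)
  note l = clinear_tensor_lift[OF cbilinear_lift_inner[OF f]]
  have 2: "tensor_lift2 f (x \<otimes> y) t = tensor_lift (f x y) t" for x y t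
    by (simp add: tensor_lift2_def tensor_lift_pure cbilinear_lift_inner[OF f])
  have l': "clinear (\<lambda>s. tensor_lift2 f s t)" for t
    using l by (simp add: tensor_lift2_def)
  have add: "clinear (\<lambda>s. tensor_lift2 f s t + tensor_lift2 f s t')" for t t'
    by (rule clinearI) (simp_all add: clinear_add[OF l'] clinear_scale[OF l'] scaleC_add_right algebra_simps)
  have scale: "clinear (\<lambda>s. c *\<^sub>C tensor_lift2 f s t)" for c t
    by (rule clinearI) (simp_all add: clinear_add[OF l'] clinear_scale[OF l'] scaleC_add_right
        scaleC_scaleC mult.commute)
  show ?thesis unfolding cbilinear_def
    by (intro conjI allI l') (intro clinearI; rule clinear_eq_pure[OF l' add] clinear_eq_pure[OF l' scale];
       simp add: 2 clinear_add[OF clinear_tensor_lift[OF 1]] clinear_scale[OF clinear_tensor_lift[OF 1]])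
qed

section \<open>Lie algebras and Cartan subalgebras\<close>

definition lie_algebra :: "('g::complex_vector \<Rightarrow> 'g \<Rightarrow> 'g) \<Rightarrow> bool"
  where "lie_algebra br \<longleftrightarrow> cbilinear br \<and> (\<forall>x. br x x = 0) \<and>
     (\<forall>x y z. br x (br y z) + br y (br z x) + br z (br x y) = 0)"

definition lie_ideal :: "('g::complex_vector \<Rightarrow> 'g \<Rightarrow> 'g) \<Rightarrow> 'g set \<Rightarrow> bool"
  where "lie_ideal br I \<longleftrightarrow> complex_vector.subspace I \<and> (\<forall>x. \<forall>y\<in>I. br x y \<in> I)"

definition simple_lie_algebra :: "('g::complex_vector \<Rightarrow> 'g \<Rightarrow> 'g) \<Rightarrow> bool"
  where "simple_lie_algebra br \<longleftrightarrow> lie_algebra br \<and> (\<exists>x y. br x y \<noteq> 0) \<and>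
     (\<forall>I. lie_ideal br I \<longrightarrow> I = {0} \<or> I = UNIV)"

definition lie_subalgebra :: "('g::complex_vector \<Rightarrow> 'g \<Rightarrow> 'g) \<Rightarrow> 'g set \<Rightarrow> bool"
  where "lie_subalgebra br L \<longleftrightarrow> complex_vector.subspace L \<and> (\<forall>x\<in>L. \<forall>y\<in>L. br x y \<in> L)"

fun lower_central :: "('g::complex_vector \<Rightarrow> 'g \<Rightarrow> 'g) \<Rightarrow> 'g set \<Rightarrow> nat \<Rightarrow> 'g set"
  where "lower_central br L 0 = L"
  | "lower_central br L (Suc k) = complex_vector.span {br x y | x y. x \<in> L \<and> y \<in> lower_central br L k}"

text \<open>A Cartan unital_subalgebra is a nilpotent unital_subalgebra that equals its own normalizer.\<close>

definition cartan_subalgebra :: "('g::complex_vector \<Rightarrow> 'g \<Rightarrow> 'g) \<Rightarrow> 'g set \<Rightarrow> bool"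
  where "cartan_subalgebra br h \<longleftrightarrow> lie_subalgebra br h \<and> (\<exists>k. lower_central br h k = {0}) \<and>
     {x. \<forall>y\<in>h. br x y \<in> h} = h"

definition root_space :: "('g::complex_vector \<Rightarrow> 'g \<Rightarrow> 'g) \<Rightarrow> 'g set \<Rightarrow> ('g \<Rightarrow> complex) \<Rightarrow> 'g set"
  where "root_space br h \<alpha> = {x. \<forall>y\<in>h. br y x = \<alpha> y *\<^sub>C x}"

definition roots :: "('g::complex_vector \<Rightarrow> 'g \<Rightarrow> 'g) \<Rightarrow> 'g set \<Rightarrow> ('g \<Rightarrow> complex) set"
  where "roots br h = {\<alpha> \<in> dual h. \<alpha> \<noteq> (\<lambda>_. 0) \<and> root_space br h \<alpha> \<noteq> {0}}"

text \<open>The form on the dual of \<open>h\<close> transported from \<open>h\<close>: \<open>(\<alpha>, \<beta>) = (t\<^sub>\<alpha>, t\<^sub>\<beta>)\<close>, where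
  \<open>t\<^sub>\<alpha> \<in> h\<close> represents \<open>\<alpha>\<close>.\<close>

definition dual_form :: "('g::complex_vector \<Rightarrow> 'g \<Rightarrow> complex) \<Rightarrow> 'g set \<Rightarrow> ('g \<Rightarrow> complex) \<Rightarrow> ('g \<Rightarrow> complex) \<Rightarrow> complex"
  where "dual_form form h \<alpha> \<beta> =
     (let t = (\<lambda>\<gamma>. THE z. z \<in> h \<and> (\<forall>y\<in>h. form z y = \<gamma> y)) in form (t \<alpha>) (t \<beta>))"

text \<open>Normalized means, as usual, that long roots have square length 2.\<close>

definition normalized_invariant_form ::
  "('g::complex_vector \<Rightarrow> 'g \<Rightarrow> 'g) \<Rightarrow> 'g set \<Rightarrow> ('g \<Rightarrow> 'g \<Rightarrow> complex) \<Rightarrow> bool"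
  where "normalized_invariant_form br h form \<longleftrightarrow>
     cbilinear form \<and>
     (\<forall>x y. form x y = form y x) \<and>
     (\<forall>x y z. form (br x y) z = form x (br y z)) \<and>
     (\<forall>x. (\<forall>y. form x y = 0) \<longrightarrow> x = 0) \<and>
     (\<forall>\<theta>\<in>roots br h. (\<forall>\<alpha>\<in>roots br h. norm (dual_form form h \<alpha> \<alpha>) \<le> norm (dual_form form h \<theta> \<theta>))
        \<longrightarrow> dual_form form h \<theta> \<theta> = 2)"

section \<open>Commutative associative algebras\<close>

text \<open>Since \<open>comm_ring_1\<close> demands \<open>0 \<noteq> 1\<close>, the zero algebra is excluded.\<close>

class complex_comm_algebra = complex_vector + comm_ring_1 +
  assumes scaleC_mult_left: "(a *\<^sub>C x) * y = a *\<^sub>C (x * y)"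

definition unital_subalgebra :: "'b::complex_comm_algebra set \<Rightarrow> bool"
  where "unital_subalgebra U \<longleftrightarrow> complex_vector.subspace U \<and> 1 \<in> U \<and> (\<forall>x\<in>U. \<forall>y\<in>U. x * y \<in> U)"

definition finitely_generated_algebra :: "'b::complex_comm_algebra itself \<Rightarrow> bool"
  where "finitely_generated_algebra _ \<longleftrightarrow> (\<exists>S::'b set. finite S \<and> unital_subalgebra hull S = UNIV)"

section \<open>Laurent polynomials and differentials\<close>

text \<open>The index set \<open>{0, 1, \<dots>, n}\<close> is \<open>'n option\<close> with \<open>None\<close> in the role of \<open>0\<close> and
  \<open>Some i\<close>, \<open>i :: 'n\<close>, in the roles of \<open>1, \<dots>, n\<close>; so \<open>n = CARD('n) \<ge> 1\<close>.
  Multiplication of Laurent polynomials is the convolution product of \<open>\<Rightarrow>\<^sub>0\<close>.\<close>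

type_synonym 'n exponent = "(int, 'n option) vec"
type_synonym 'n laurent = "'n exponent \<Rightarrow>\<^sub>0 complex"
type_synonym 'n omega = "'n exponent \<times> 'n option \<Rightarrow>\<^sub>0 complex"

definition lmonom :: "('n::finite) exponent \<Rightarrow> 'n laurent"
  where "lmonom k = Poly_Mapping.single k 1"

definition omega_basis :: "('n::finite) exponent \<Rightarrow> 'n option \<Rightarrow> 'n omega"
  where "omega_basis k i = Poly_Mapping.single (k, i) 1"

definition dA :: "('n::finite) omega set"
  where "dA = complex_vector.span (range (\<lambda>k. \<Sum>i\<in>UNIV. of_int (k $ i) *\<^sub>C omega_basis k i))"

lemma subspace_dA: "complex_vector.subspace dA"
  by (simp add: dA_def)

quotient_type (overloaded) 'n Z = "('n::finite) omega" / "\<lambda>p q. p - q \<in> dA"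
  by (rule equivp_mod_subspace[OF subspace_dA])

instantiation Z :: (finite) complex_vector
begin
lift_definition zero_Z :: "'a Z" is 0 .
lift_definition plus_Z :: "'a Z \<Rightarrow> 'a Z \<Rightarrow> 'a Z" is "(+)"
proof -
  fix p q r s :: "'a omega"
  assume "p - q \<in> dA" "r - s \<in> dA"
  from complex_vector.subspace_add[OF subspace_dA this]
  show "p + r - (q + s) \<in> dA" by (simp add: algebra_simps)
qed
lift_definition minus_Z :: "'a Z \<Rightarrow> 'a Z \<Rightarrow> 'a Z" is "(-)"
proof -
  fix p q r s :: "'a omega"
  assume "p - q \<in> dA" "r - s \<in> dA"
  from complex_vector.subspace_diff[OF subspace_dA this]
  show "p - r - (q - s) \<in> dA" by (simp add: algebra_simps)
qed
lift_definition uminus_Z :: "'a Z \<Rightarrow> 'a Z" is uminus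
proof -
  fix p q :: "'a omega"
  assume "p - q \<in> dA"
  from complex_vector.subspace_neg[OF subspace_dA this]
  show "- p - - q \<in> dA" by simp
qed
lift_definition scaleC_Z :: "complex \<Rightarrow> 'a Z \<Rightarrow> 'a Z" is scaleC
proof -
  fix c and p q :: "'a omega"
  assume "p - q \<in> dA"
  from complex_vector.subspace_scale[OF subspace_dA this, of c]
  show "c *\<^sub>C p - c *\<^sub>C q \<in> dA" by (simp add: complex_vector.scale_right_diff_distrib)
qed
instance
  by standard (transfer; simp add: algebra_simps complex_vector.subspace_0[OF subspace_dA])+
end

text \<open>The class of \<open>t\<^sup>k K\<^sub>i\<close> in \<open>Z\<close>.\<close>

definition Z_elt :: "('n::finite) exponent \<Rightarrow> 'n option \<Rightarrow> 'n Z"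
  where "Z_elt k i = abs_Z (omega_basis k i)"

text \<open>The bilinear map \<open>(t\<^sup>k, t\<^sup>r) \<mapsto> \<Sum>\<^sub>i k\<^sub>i t\<^sup>k\<^sup>+\<^sup>r K\<^sub>i\<close>.\<close>

definition dmul :: "('n::finite) laurent \<Rightarrow> 'n laurent \<Rightarrow> 'n Z"
  where "dmul p q = lin_ext (\<lambda>k. lin_ext (\<lambda>r. \<Sum>i\<in>UNIV. of_int (k $ i) *\<^sub>C Z_elt (k + r) i) q) p"

text \<open>The degree derivations \<open>t\<^sup>k \<mapsto> k\<^sub>i t\<^sup>k\<close> and \<open>t\<^sup>k K\<^sub>j \<mapsto> k\<^sub>i t\<^sup>k K\<^sub>j\<close>.\<close>

definition deg_A :: "'n option \<Rightarrow> ('n::finite) laurent \<Rightarrow> 'n laurent"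
  where "deg_A i = lin_ext (\<lambda>k. of_int (k $ i) *\<^sub>C lmonom k)"

definition deg_omega :: "'n option \<Rightarrow> ('n::finite) omega \<Rightarrow> 'n omega"
  where "deg_omega i = lin_ext (\<lambda>(k, j). of_int (k $ i) *\<^sub>C omega_basis k j)"

lemma deg_omega_dA: "p \<in> dA \<Longrightarrow> deg_omega i p \<in> dA"
  unfolding dA_def
proof (induction rule: complex_vector.span_induct)
  case base
  have l: "clinear (deg_omega i)" by (simp add: deg_omega_def clinear_lin_ext)
  show ?case
    by (auto simp: complex_vector.subspace_def clinear_0[OF l] clinear_add[OF l] clinear_scale[OF l]
       complex_vector.span_zero complex_vector.span_add complex_vector.span_scale)
next
  case (step x)
  then obtain k where x: "x = (\<Sum>j\<in>UNIV. of_int (k $ j) *\<^sub>C omega_basis k j)" by auto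
  have l: "clinear (deg_omega i)" by (simp add: deg_omega_def clinear_lin_ext)
  have "deg_omega i (omega_basis k j) = of_int (k $ i) *\<^sub>C omega_basis k j" for j
    by (simp add: deg_omega_def omega_basis_def)
  then have "deg_omega i x = of_int (k $ i) *\<^sub>C x"
    by (simp add: x clinear_sum[OF l] clinear_scale[OF l] complex_vector.scale_sum_right mult.commute)
  then show ?case
    using step by (simp add: complex_vector.span_scale complex_vector.span_base)
qed

lift_definition deg_Z :: "'n option \<Rightarrow> ('n::finite) Z \<Rightarrow> 'n Z" is deg_omega
proof -
  fix i and p q :: "'n omega"
  assume "p - q \<in> dA"
  from deg_omega_dA[OF this, of i] show "deg_omega i p - deg_omega i q \<in> dA"
    by (simp add: deg_omega_def clinear_diff[OF clinear_lin_ext])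
qed

section \<open>The toroidal Lie algebra\<close>

text \<open>\<open>\<tau>\<^sub>0 = g \<otimes> A \<oplus> Z\<close> and \<open>\<tau>(B) = \<tau>\<^sub>0 \<otimes> B \<oplus> D\<close>, where \<open>D\<close> has coordinates with respect to
  the basis \<open>d\<^sub>0, \<dots>, d\<^sub>n\<close>.\<close>

type_synonym ('g, 'n) tau0 = "('g, 'n laurent) tensor \<times> 'n Z"
type_synonym ('g, 'n, 'b) tau = "(('g, 'n) tau0, 'b) tensor \<times> (complex, 'n option) vec"

definition tau0_bracket ::
  "('g \<Rightarrow> 'g \<Rightarrow> 'g) \<Rightarrow> ('g \<Rightarrow> 'g \<Rightarrow> complex) \<Rightarrow>
     ('g::complex_vector, 'n::finite) tau0 \<Rightarrow> ('g, 'n) tau0 \<Rightarrow> ('g, 'n) tau0"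
  where "tau0_bracket br form u v =
     tensor_lift2 (\<lambda>x p y q. (br x y \<otimes> (p * q), form x y *\<^sub>C dmul p q)) (fst u) (fst v)"

definition tau0_deg :: "'n option \<Rightarrow> ('g::complex_vector, 'n::finite) tau0 \<Rightarrow> ('g, 'n) tau0"
  where "tau0_deg i u = (tensor_lift (\<lambda>x p. x \<otimes> deg_A i p) (fst u), deg_Z i (snd u))"

definition tau_deg :: "(complex, 'n option) vec \<Rightarrow>
     (('g::complex_vector, 'n::finite) tau0, 'b::complex_vector) tensor \<Rightarrow> (('g, 'n) tau0, 'b) tensor"
  where "tau_deg d s = (\<Sum>i\<in>UNIV. (d $ i) *\<^sub>C tensor_lift (\<lambda>u b. tau0_deg i u \<otimes> b) s)"

definition tau_bracket ::
  "('g \<Rightarrow> 'g \<Rightarrow> 'g) \<Rightarrow> ('g \<Rightarrow> 'g \<Rightarrow> complex) \<Rightarrow>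
     ('g::complex_vector, 'n::finite, 'b::complex_comm_algebra) tau \<Rightarrow> ('g, 'n, 'b) tau \<Rightarrow> ('g, 'n, 'b) tau"
  where "tau_bracket br form X Y =
     (tensor_lift2 (\<lambda>u b v b'. tau0_bracket br form u v \<otimes> (b * b')) (fst X) (fst Y)
        + tau_deg (snd X) (fst Y) - tau_deg (snd Y) (fst X), 0)"

text \<open>The elements \<open>x \<otimes> t\<^sup>k \<otimes> b\<close>, \<open>t\<^sup>k K\<^sub>i \<otimes> b\<close> and \<open>d\<^sub>i\<close>.\<close>

definition loop_elt :: "'g::complex_vector \<Rightarrow> ('n::finite) exponent \<Rightarrow> 'b::complex_vector \<Rightarrow> ('g, 'n, 'b) tau"
  where "loop_elt x k b = ((x \<otimes> lmonom k, 0) \<otimes> b, 0)"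

definition K_elt :: "('n::finite) exponent \<Rightarrow> 'n option \<Rightarrow> 'b::complex_vector \<Rightarrow> ('g::complex_vector, 'n, 'b) tau"
  where "K_elt k i b = ((0, Z_elt k i) \<otimes> b, 0)"

definition d_elt :: "'n option \<Rightarrow> ('g::complex_vector, 'n::finite, 'b::complex_vector) tau"
  where "d_elt i = (0, axis i 1)"

definition H_tau :: "'g::complex_vector set \<Rightarrow> ('g, 'n::finite, 'b::complex_comm_algebra) tau set"
  where "H_tau h = complex_vector.span ((\<lambda>x. loop_elt x 0 1) ` h \<union> range (\<lambda>i. K_elt 0 i 1) \<union> range d_elt)"

section \<open>Modules\<close>

definition lie_module :: "('l::complex_vector \<Rightarrow> 'l \<Rightarrow> 'l) \<Rightarrow> ('l \<Rightarrow> 'v::complex_vector \<Rightarrow> 'v) \<Rightarrow> bool"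
  where "lie_module br \<rho> \<longleftrightarrow> cbilinear \<rho> \<and> (\<forall>x y v. \<rho> (br x y) v = \<rho> x (\<rho> y v) - \<rho> y (\<rho> x v))"

definition irreducible_module :: "('l::complex_vector \<Rightarrow> 'v::complex_vector \<Rightarrow> 'v) \<Rightarrow> bool"
  where "irreducible_module \<rho> \<longleftrightarrow> (\<exists>v::'v. v \<noteq> 0) \<and>
     (\<forall>W. complex_vector.subspace W \<and> (\<forall>x. \<forall>w\<in>W. \<rho> x w \<in> W) \<longrightarrow> W = {0} \<or> W = UNIV)"

definition weight_space :: "('l::complex_vector \<Rightarrow> 'v::complex_vector \<Rightarrow> 'v) \<Rightarrow> 'l set \<Rightarrow> ('l \<Rightarrow> complex) \<Rightarrow> 'v set"
  where "weight_space \<rho> H \<mu> = {v. \<forall>x\<in>H. \<rho> x v = \<mu> x *\<^sub>C v}"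

definition integrable_module :: "('g::complex_vector \<Rightarrow> 'g \<Rightarrow> 'g) \<Rightarrow> 'g set \<Rightarrow>
    (('g, 'n::finite, 'b::complex_comm_algebra) tau \<Rightarrow> 'v::complex_vector \<Rightarrow> 'v) \<Rightarrow> bool"
  where "integrable_module br h \<rho> \<longleftrightarrow>
     is_direct_sum (dual (H_tau h)) (weight_space \<rho> (H_tau h)) \<and>
     (\<forall>\<alpha>\<in>roots br h. \<forall>x\<in>root_space br h \<alpha>. \<forall>m b v. \<exists>k. (\<rho> (loop_elt x m b) ^^ k) v = 0)"

section \<open>The bracket in terms of generators\<close>

lemma abs_Z_clinear: "clinear abs_Z"
  by (rule clinearI) (simp_all add: plus_Z.abs_eq scaleC_Z.abs_eq)

lemma clinear_eq_Z:
  assumes "clinear f" "clinear g" "\<And>k i. f (Z_elt k i) = g (Z_elt k i)"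
  shows "f z = g z"
proof -
  have "f (abs_Z p) = g (abs_Z p)" for p
    by (rule clinear_eq_basis[OF clinear_compose[OF assms(1) abs_Z_clinear]
          clinear_compose[OF assms(2) abs_Z_clinear]])
       (use assms(3) in \<open>auto simp: Z_elt_def omega_basis_def\<close>)
  then show ?thesis by (induction z rule: Z.abs_induct) simp
qed

lemma Z_relation: "(\<Sum>i\<in>UNIV. of_int (k $ i) *\<^sub>C Z_elt k i) = 0"
proof -
  have "(\<Sum>i\<in>UNIV. of_int (k $ i) *\<^sub>C Z_elt k i) = abs_Z (\<Sum>i\<in>UNIV. of_int (k $ i) *\<^sub>C omega_basis k i)"
    by (simp add: Z_elt_def clinear_sum[OF abs_Z_clinear] scaleC_Z.abs_eq)
  also have "\<dots> = abs_Z 0"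
    unfolding Z.abs_eq_iff by (simp add: dA_def complex_vector.span_base)
  finally show ?thesis by (simp add: zero_Z_def)
qed

lemma lmonom_mult: "lmonom k * lmonom r = lmonom (k + r)"
  by (simp add: lmonom_def mult_single)

lemma dmul_lmonom: "dmul (lmonom k) (lmonom r) = (\<Sum>i\<in>UNIV. of_int (k $ i) *\<^sub>C Z_elt (k + r) i)"
  by (simp add: dmul_def lmonom_def)

lemma cbilinear_dmul: "cbilinear dmul"
  unfolding cbilinear_def dmul_def
  by (auto intro!: clinear_lin_ext clinear_lin_ext_fun)

lemma deg_A_lmonom: "deg_A i (lmonom k) = of_int (k $ i) *\<^sub>C lmonom k"
  by (simp add: deg_A_def lmonom_def)

lemma clinear_deg_A: "clinear (deg_A i)"
  by (simp add: deg_A_def clinear_lin_ext)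

lemma deg_Z_elt: "deg_Z i (Z_elt k j) = of_int (k $ i) *\<^sub>C Z_elt k j"
  by (simp add: Z_elt_def deg_Z.abs_eq scaleC_Z.abs_eq deg_omega_def omega_basis_def)

lemma clinear_deg_Z: "clinear (deg_Z i)"
proof (rule clinearI)
  show "deg_Z i (x + y) = deg_Z i x + deg_Z i y" for x y
    by (induction x rule: Z.abs_induct, induction y rule: Z.abs_induct)
       (simp add: plus_Z.abs_eq deg_Z.abs_eq deg_omega_def clinear_add[OF clinear_lin_ext])
  show "deg_Z i (c *\<^sub>C x) = c *\<^sub>C deg_Z i x" for c x
    by (induction x rule: Z.abs_induct)
       (simp add: scaleC_Z.abs_eq deg_Z.abs_eq deg_omega_def clinear_scale[OF clinear_lin_ext])
qed

lemma scaleC_mult_right: "x * (a *\<^sub>C y) = a *\<^sub>C (x * y)" for x y :: "'b::complex_comm_algebra"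
  by (metis mult.commute scaleC_mult_left)

lemma cbilinear_mult: "cbilinear ((*) :: 'b::complex_comm_algebra \<Rightarrow> 'b \<Rightarrow> 'b)"
  unfolding cbilinear_def
  by (auto intro!: clinearI simp: algebra_simps scaleC_mult_left scaleC_mult_right)

lemma laurent_scaleC: "c *\<^sub>C p = Poly_Mapping.single 0 c * p" for p :: "'n::finite laurent"
proof -
  have "c *\<^sub>C p = Poly_Mapping.map ((*) c) p"
    by (rule poly_mapping_eqI) (simp add: lookup_scaleC scaleC_complex_def Poly_Mapping.map.rep_eq when_def)
  then show ?thesis by (simp add: mult_map_scale_conv_mult)
qed

lemma cbilinear_laurent_mult: "cbilinear ((*) :: 'n::finite laurent \<Rightarrow> _)"
  unfolding cbilinear_def
  by (auto intro!: clinearI simp: algebra_simps laurent_scaleC)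

lemma scaleC_Pair: "c *\<^sub>C (x, y) = (c *\<^sub>C x, c *\<^sub>C y)"
  by (simp add: scaleC_prod_def)

lemmas tensor_add = clinear_add[OF cbilinearD(1)[OF cbilinear_tensor]] clinear_add[OF cbilinearD(2)[OF cbilinear_tensor]]
lemmas tensor_scale = clinear_scale[OF cbilinearD(1)[OF cbilinear_tensor]] clinear_scale[OF cbilinearD(2)[OF cbilinear_tensor]]
lemmas tensor_0 = clinear_0[OF cbilinearD(1)[OF cbilinear_tensor]] clinear_0[OF cbilinearD(2)[OF cbilinear_tensor]]
lemmas mult_scale = clinear_scale[OF cbilinearD(1)[OF cbilinear_laurent_mult]] clinear_scale[OF cbilinearD(2)[OF cbilinear_laurent_mult]]
lemmas dmul_add = clinear_add[OF cbilinearD(1)[OF cbilinear_dmul]] clinear_add[OF cbilinearD(2)[OF cbilinear_dmul]]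
lemmas dmul_scale = clinear_scale[OF cbilinearD(1)[OF cbilinear_dmul]] clinear_scale[OF cbilinearD(2)[OF cbilinear_dmul]]

lemma cbilinear_deg_tensor: "cbilinear (\<lambda>x p. x \<otimes> deg_A i p)"
  unfolding cbilinear_def
  by (auto intro!: clinearI simp: tensor_add tensor_scale clinear_add[OF clinear_deg_A] clinear_scale[OF clinear_deg_A])

lemma clinear_tau0_deg: "clinear (tau0_deg i)"
  by (rule clinearI)
     (simp_all add: tau0_deg_def scaleC_prod_def clinear_add[OF clinear_deg_Z] clinear_scale[OF clinear_deg_Z]
       clinear_add[OF clinear_tensor_lift[OF cbilinear_deg_tensor]]
       clinear_scale[OF clinear_tensor_lift[OF cbilinear_deg_tensor]])

lemma cbilinear_tau0_deg_tensor: "cbilinear (\<lambda>u b. tau0_deg i u \<otimes> b)"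
  unfolding cbilinear_def
  by (intro conjI allI clinearI)
     (simp_all add: tensor_add tensor_scale clinear_add[OF clinear_tau0_deg] clinear_scale[OF clinear_tau0_deg])

lemma clinear_tau_deg: "clinear (tau_deg d)"
  unfolding tau_deg_def
  by (rule clinearI)
     (simp_all add: clinear_add[OF clinear_tensor_lift[OF cbilinear_tau0_deg_tensor]]
       clinear_scale[OF clinear_tensor_lift[OF cbilinear_tau0_deg_tensor]]
       complex_vector.scale_right_distrib sum.distrib complex_vector.scale_sum_right mult.commute)

lemma cbilinear_tau_deg: "cbilinear tau_deg"
  unfolding cbilinear_def
proof (intro conjI allI clinear_tau_deg clinearI)
  show "tau_deg (d + e) s = tau_deg d s + tau_deg e s" for d e s
    by (simp add: tau_deg_def complex_vector.scale_left_distrib sum.distrib)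
  show "tau_deg (c *\<^sub>C d) s = c *\<^sub>C tau_deg d s" for c d s
    by (simp add: tau_deg_def scaleC_vec_def scaleC_complex_def complex_vector.scale_sum_right)
qed

lemma tau_deg_axis: "tau_deg (axis i 1) (u \<otimes> b) = tau0_deg i u \<otimes> b"
proof -
  have "tau_deg (axis i 1) (u \<otimes> b) = (\<Sum>j\<in>UNIV. if j = i then tau0_deg i u \<otimes> b else 0)"
    unfolding tau_deg_def tensor_lift_pure[OF cbilinear_tau0_deg_tensor]
    by (rule sum.cong) (auto simp: axis_def)
  then show ?thesis by simp
qed

lemma quadrilinear_tau0_bracket:
  assumes br: "cbilinear br" and form: "cbilinear form"
  shows "quadrilinear (\<lambda>x (p :: 'n::finite laurent) y q. (br x y \<otimes> (p * q), form x y *\<^sub>C dmul p q))"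
  unfolding quadrilinear_def cbilinear_def
  by (auto intro!: clinearI simp: scaleC_Pair tensor_add tensor_scale distrib_left distrib_right mult_scale dmul_add dmul_scale
      clinear_add[OF cbilinearD(1)[OF br]] clinear_add[OF cbilinearD(2)[OF br]]
      clinear_scale[OF cbilinearD(1)[OF br]] clinear_scale[OF cbilinearD(2)[OF br]]
      clinear_add[OF cbilinearD(1)[OF form]] clinear_add[OF cbilinearD(2)[OF form]]
      clinear_scale[OF cbilinearD(1)[OF form]] clinear_scale[OF cbilinearD(2)[OF form]]
      complex_vector.scale_left_distrib complex_vector.scale_right_distrib scaleC_complex_def mult.commute)

lemma cbilinear_tau0_bracket:
  assumes "cbilinear br" "cbilinear form"
  shows "cbilinear (tau0_bracket br form)"
proof -
  note * = cbilinear_tensor_lift2[OF quadrilinear_tau0_bracket[OF assms]]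
  note cbilinearD[OF *, THEN clinear_add] cbilinearD[OF *, THEN clinear_scale]
  then show ?thesis
    unfolding cbilinear_def tau0_bracket_def
    by (auto intro!: clinearI simp: scaleC_prod_def)
qed

lemma quadrilinear_tau_bracket:
  assumes "cbilinear br" "cbilinear form"
  shows "quadrilinear (\<lambda>u (b::'b::complex_comm_algebra) v b'. tau0_bracket br form u v \<otimes> (b * b'))"
proof -
  note * = cbilinear_tau0_bracket[OF assms]
  show ?thesis
    unfolding quadrilinear_def cbilinear_def
    by (intro conjI allI clinearI)
       (simp_all add: tensor_add tensor_scale distrib_left distrib_right
        scaleC_mult_left scaleC_mult_right
        clinear_add[OF cbilinearD(1)[OF *]] clinear_add[OF cbilinearD(2)[OF *]]
        clinear_scale[OF cbilinearD(1)[OF *]] clinear_scale[OF cbilinearD(2)[OF *]])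
qed

lemma cbilinear_tau_bracket:
  assumes "cbilinear br" "cbilinear form"
  shows "cbilinear (tau_bracket br form)"
proof -
  note * = cbilinear_tensor_lift2[OF quadrilinear_tau_bracket[OF assms]]
  have deg: "tau_deg (d + e) s = tau_deg d s + tau_deg e s" "tau_deg d (s + t) = tau_deg d s + tau_deg d t"
    "tau_deg (c *\<^sub>C d) s = c *\<^sub>C tau_deg d s" "tau_deg d (c *\<^sub>C s) = c *\<^sub>C tau_deg d s" for d e s t c
    by (rule clinear_add[OF cbilinearD(2)[OF cbilinear_tau_deg]] clinear_add[OF clinear_tau_deg]
        clinear_scale[OF cbilinearD(2)[OF cbilinear_tau_deg]] clinear_scale[OF clinear_tau_deg])+
  show ?thesis
    unfolding cbilinear_def tau_bracket_def
    by (intro conjI allI clinearI)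
       (simp_all add: scaleC_prod_def deg
        clinear_add[OF cbilinearD(1)[OF *]] clinear_add[OF cbilinearD(2)[OF *]]
        clinear_scale[OF cbilinearD(1)[OF *]] clinear_scale[OF cbilinearD(2)[OF *]]
        complex_vector.scale_right_distrib complex_vector.scale_right_diff_distrib)
qed

lemma tau_deg_0: "tau_deg 0 s = 0" "tau_deg d 0 = 0"
  using clinear_0[OF cbilinearD(2)[OF cbilinear_tau_deg]] clinear_0[OF clinear_tau_deg] by auto

lemma bracket_d_d: "cbilinear br \<Longrightarrow> cbilinear form \<Longrightarrow> tau_bracket br form (d_elt i) (d_elt j) = 0"
  using clinear_0[OF cbilinearD(1)[OF cbilinear_tensor_lift2[OF quadrilinear_tau_bracket]]]
  by (simp add: tau_bracket_def d_elt_def tau_deg_0 zero_prod_def)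

context
  fixes br :: "'g::complex_vector \<Rightarrow> 'g \<Rightarrow> 'g" and form :: "'g \<Rightarrow> 'g \<Rightarrow> complex"
  assumes br: "cbilinear br" and form: "cbilinear form"
begin

lemma tau0_bracket_pure:
  "tau0_bracket br form (x \<otimes> p, z) (y \<otimes> q, z') = (br x y \<otimes> (p * q), form x y *\<^sub>C dmul p q)"
  by (simp add: tau0_bracket_def tensor_lift2_pure[OF quadrilinear_tau0_bracket[OF br form]])

lemma tau0_bracket_0: "tau0_bracket br form (0, z) v = 0" "tau0_bracket br form v (0, z) = 0"
  unfolding tau0_bracket_def
  using clinear_0[OF cbilinearD(1)[OF cbilinear_tensor_lift2[OF quadrilinear_tau0_bracket[OF br form]]]]
    clinear_0[OF cbilinearD(2)[OF cbilinear_tensor_lift2[OF quadrilinear_tau0_bracket[OF br form]]]]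
  by auto

lemma tau_bracket_pure:
  "tau_bracket br form (u \<otimes> b, 0) (v \<otimes> b', 0) = (tau0_bracket br form u v \<otimes> (b * b'), 0)"
  by (simp add: tau_bracket_def tensor_lift2_pure[OF quadrilinear_tau_bracket[OF br form]] tau_deg_0)

lemma bracket_loop_loop:
  fixes k r :: "'n::finite exponent" and b b' :: "'b::complex_comm_algebra"
  shows "tau_bracket br form (loop_elt x k b) (loop_elt y r b') =
     loop_elt (br x y) (k + r) (b * b') + form x y *\<^sub>C (\<Sum>i\<in>UNIV. of_int (k $ i) *\<^sub>C K_elt (k + r) i (b * b'))"
proof -
  define e where "e z = (((0, z) \<otimes> (b * b'), 0) :: ('g, 'n, 'b) tau)" for z
  have e: "clinear e"
  proof (rule clinearI)
    show "e (z + z') = e z + e z'" for z z'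
      using tensor_add(2)[of "(0, z)" "(0, z')" "b * b'"] by (simp add: e_def)
    show "e (c *\<^sub>C z) = c *\<^sub>C e z" for c z
      using tensor_scale(2)[of c "(0, z)" "b * b'"] by (simp add: e_def scaleC_Pair)
  qed
  have "tau_bracket br form (loop_elt x k b) (loop_elt y r b') =
      ((br x y \<otimes> lmonom (k + r), form x y *\<^sub>C dmul (lmonom k) (lmonom r)) \<otimes> (b * b'), 0)"
    by (simp add: loop_elt_def tau_bracket_pure tau0_bracket_pure lmonom_mult)
  also have "\<dots> = loop_elt (br x y) (k + r) (b * b') + e (form x y *\<^sub>C dmul (lmonom k) (lmonom r))"
    using tensor_add(2)[of "(br x y \<otimes> lmonom (k + r), 0)" "(0, form x y *\<^sub>C dmul (lmonom k) (lmonom r))" "b * b'"]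
    by (simp add: loop_elt_def e_def)
  also have "e (form x y *\<^sub>C dmul (lmonom k) (lmonom r)) =
      form x y *\<^sub>C (\<Sum>i\<in>UNIV. of_int (k $ i) *\<^sub>C K_elt (k + r) i (b * b'))"
    by (simp add: dmul_lmonom clinear_scale[OF e] clinear_sum[OF e]) (simp add: e_def K_elt_def)
  finally show ?thesis .
qed

lemma bracket_K: "tau_bracket br form (K_elt k i b) (loop_elt y r b') = 0"
  "tau_bracket br form (loop_elt y r b') (K_elt k i b) = 0"
  "tau_bracket br form (K_elt k i b) (K_elt r j b') = 0"
  by (simp_all add: loop_elt_def K_elt_def tau_bracket_pure tau0_bracket_0 tensor_0 zero_prod_def[symmetric])

lemma bracket_d:
  "tau_bracket br form (d_elt i) (s, 0) = (tau_deg (axis i 1) s, 0)"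
  "tau_bracket br form (s, 0) (d_elt i) = - (tau_deg (axis i 1) s, 0)"
  using clinear_0[OF cbilinearD(1)[OF cbilinear_tensor_lift2[OF quadrilinear_tau_bracket[OF br form]]]]
    clinear_0[OF cbilinearD(2)[OF cbilinear_tensor_lift2[OF quadrilinear_tau_bracket[OF br form]]]]
  by (simp_all add: tau_bracket_def d_elt_def tau_deg_0)

lemma bracket_d_loop:
  "tau_bracket br form (d_elt i) (loop_elt x k b) = of_int (k $ i) *\<^sub>C loop_elt x k b"
  by (simp add: loop_elt_def bracket_d tau_deg_axis tau0_deg_def tensor_lift_pure[OF cbilinear_deg_tensor]
     deg_A_lmonom tensor_scale clinear_0[OF clinear_deg_Z] scaleC_Pair)
     (simp add: tensor_scale(2)[symmetric] scaleC_Pair)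

lemma bracket_d_K:
  "tau_bracket br form (d_elt i) (K_elt k j b) = of_int (k $ i) *\<^sub>C K_elt k j b"
  by (simp add: K_elt_def bracket_d tau_deg_axis tau0_deg_def deg_Z_elt
     clinear_0[OF clinear_tensor_lift[OF cbilinear_deg_tensor]] scaleC_Pair)
     (simp add: tensor_scale(2)[symmetric] scaleC_Pair)

end

lemma tau_generators:
  fixes f :: "('g::complex_vector, 'n::finite, 'b::complex_comm_algebra) tau \<Rightarrow> 'v::complex_vector"
  assumes f: "clinear f"
    and loop: "\<And>x k b. f (loop_elt x k b) = 0" and K: "\<And>k i b. f (K_elt k i b) = 0" and d: "\<And>i. f (d_elt i) = 0"
  shows "f X = 0"
proof -
  have zero: "clinear (\<lambda>_. 0)" by (rule clinearI) simp_all
  have l1: "clinear (\<lambda>s. f (s, 0))"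
    by (rule clinearI) (simp_all flip: clinear_add[OF f] clinear_scale[OF f] add: scaleC_Pair)
  have l2: "clinear (\<lambda>t. f ((t, 0) \<otimes> b, 0))" for b
    by (rule clinearI) (simp_all flip: clinear_add[OF l1] clinear_scale[OF l1] tensor_add(2) tensor_scale(2) add: scaleC_Pair)
  have l3: "clinear (\<lambda>p. f ((x \<otimes> p, 0) \<otimes> b, 0))" for x b
    by (rule clinearI) (simp_all add: tensor_add tensor_scale clinear_add[OF l2] clinear_scale[OF l2])
  have l4: "clinear (\<lambda>z. f ((0, z) \<otimes> b, 0))" for b
    by (rule clinearI) (simp_all flip: clinear_add[OF l1] clinear_scale[OF l1] tensor_add(2) tensor_scale(2) add: scaleC_Pair)
  have "f ((x \<otimes> p, 0) \<otimes> b, 0) = 0" for x p b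
    by (rule clinear_eq_basis[OF l3 zero]) (use loop in \<open>simp add: loop_elt_def lmonom_def\<close>)
  then have 1: "f ((t, 0) \<otimes> b, 0) = 0" for t b
    by (rule clinear_eq_pure[OF l2 zero])
  have 2: "f ((0, z) \<otimes> b, 0) = 0" for z b
    by (rule clinear_eq_Z[OF l4 zero]) (use K in \<open>simp add: K_elt_def\<close>)
  have "f ((t, z) \<otimes> b, 0) = 0" for t z b
    using 1[of t b] 2[of z b] clinear_add[OF l1, of "(t, 0) \<otimes> b" "(0, z) \<otimes> b"]
    by (simp flip: tensor_add)
  then have "f (u \<otimes> b, 0) = 0" for u b
    by (cases u) auto
  then have 3: "f (s, 0) = 0" for s
    by (rule clinear_eq_pure[OF l1 zero])
  obtain s c where X: "X = (s, c)" by (cases X)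
  have "(\<Sum>i\<in>UNIV. (c $ i) *\<^sub>C axis i (1::complex)) $ j = c $ j" for j
  proof -
    have "(\<Sum>i\<in>UNIV. (c $ i) *\<^sub>C axis i (1::complex)) $ j = (\<Sum>i\<in>UNIV. if i = j then c $ i else 0)"
      unfolding sum_component by (rule sum.cong) (auto simp: scaleC_vec_def axis_def scaleC_complex_def)
    then show ?thesis by simp
  qed
  then have "(\<Sum>i\<in>UNIV. (c $ i) *\<^sub>C axis i (1::complex)) = c"
    by (simp add: vec_eq_iff)
  moreover have "(\<Sum>i\<in>UNIV. (c $ i) *\<^sub>C (d_elt i :: ('g, 'n, 'b) tau)) = (0, \<Sum>i\<in>UNIV. (c $ i) *\<^sub>C axis i (1::complex))"
    by (simp add: d_elt_def scaleC_Pair sum_prod)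
  ultimately have "X = (s, 0) + (\<Sum>i\<in>UNIV. (c $ i) *\<^sub>C d_elt i)"
    by (simp add: X)
  then have "f X = f (s, 0) + (\<Sum>i\<in>UNIV. (c $ i) *\<^sub>C f (d_elt i))"
    by (simp only: clinear_add[OF f] clinear_sum[OF f] clinear_scale[OF f])
  then show ?thesis by (simp add: 3 d)
qed

lemma tau_bracket_lie_algebra:
  fixes br :: "'g::complex_vector \<Rightarrow> 'g \<Rightarrow> 'g"
  assumes L: "lie_algebra br" and form: "cbilinear form" and sym: "\<And>x y. form x y = form y x"
    and inv: "\<And>x y z. form (br x y) z = form x (br y z)"
  shows "lie_algebra (tau_bracket br form ::
    ('g, 'n::finite, 'b::complex_comm_algebra) tau \<Rightarrow> ('g, 'n, 'b) tau \<Rightarrow> ('g, 'n, 'b) tau)"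
proof -
  have br: "cbilinear br" and alt: "\<And>x. br x x = 0"
    and jac: "\<And>x y z. br x (br y z) + br y (br z x) + br z (br x y) = 0"
    using L by (auto simp: lie_algebra_def)
  let ?T = "tau_bracket br form :: ('g, 'n, 'b) tau \<Rightarrow> ('g, 'n, 'b) tau \<Rightarrow> ('g, 'n, 'b) tau"
  note bil = cbilinear_tau_bracket[OF br form]
  note T1 = cbilinearD(1)[OF bil] and T2 = cbilinearD(2)[OF bil]
  note Tadd = clinear_add[OF T1] clinear_add[OF T2] and Tscale = clinear_scale[OF T1] clinear_scale[OF T2]
  have skew_g: "br x y = - br y x" for x y
  proof -
    have "br (x + y) (x + y) = br x x + br y x + (br x y + br y y)"
      unfolding clinear_add[OF cbilinearD(1)[OF br]] clinear_add[OF cbilinearD(2)[OF br]] ..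
    then have "br x y + br y x = 0"
      unfolding alt add_0_left add_0_right by (metis add.commute)
    then show ?thesis
      by (simp only: eq_neg_iff_add_eq_0)
  qed
  define kd where "kd k m b = (\<Sum>i\<in>UNIV. of_int (k $ i) *\<^sub>C K_elt m i b :: ('g, 'n, 'b) tau)" for k m b
  have K: "clinear (\<lambda>z. ((0, z) \<otimes> b, 0) :: ('g, 'n, 'b) tau)" for b
  proof (rule clinearI)
    show "((0, z + z') \<otimes> b, 0) = (((0, z) \<otimes> b, 0) :: ('g, 'n, 'b) tau) + ((0, z') \<otimes> b, 0)" for z z'
      using tensor_add(2)[of "(0, z)" "(0, z')" b] by simp
    show "((0, c *\<^sub>C z) \<otimes> b, 0) = c *\<^sub>C (((0, z) \<otimes> b, 0) :: ('g, 'n, 'b) tau)" for c z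
      using tensor_scale(2)[of c "(0, z)" b] by (simp add: scaleC_Pair)
  qed
  have kd_self: "kd m m b = 0" for m b
    using Z_relation[of m] clinear_0[OF K]
    by (simp add: kd_def K_elt_def clinear_sum[OF K, symmetric] clinear_scale[OF K, symmetric])
  have kd_add: "kd (k + r) m b = kd k m b + kd r m b" for k r m b
    by (simp add: kd_def complex_vector.scale_left_distrib sum.distrib)
  have loop: "clinear (\<lambda>x. loop_elt x k b :: ('g, 'n, 'b) tau)" for k b
  proof (rule clinearI)
    show "loop_elt (x + y) k b = (loop_elt x k b :: ('g, 'n, 'b) tau) + loop_elt y k b" for x y
      using tensor_add(2)[of "(x \<otimes> lmonom k, 0)" "(y \<otimes> lmonom k, 0)" b] by (simp add: loop_elt_def tensor_add)
    show "loop_elt (c *\<^sub>C x) k b = c *\<^sub>C (loop_elt x k b :: ('g, 'n, 'b) tau)" for c x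
      using tensor_scale(2)[of c "(x \<otimes> lmonom k, 0)" b] by (simp add: loop_elt_def tensor_scale scaleC_Pair)
  qed
  note loop_add = clinear_add[OF loop, symmetric]
  have LL: "?T (loop_elt x k b) (loop_elt y r b') = loop_elt (br x y) (k + r) (b * b') + form x y *\<^sub>C kd k (k + r) (b * b')"
    for x y k r b b' unfolding kd_def by (rule bracket_loop_loop[OF br form])
  have Lkd: "?T (loop_elt x k b) (kd r m b') = 0" "?T (kd r m b') (loop_elt x k b) = 0"
    "?T (K_elt k i b) (kd r m b') = 0" for x k b r m b' i
    by (simp_all add: kd_def clinear_sum[OF T1] clinear_sum[OF T2] Tscale bracket_K[OF br form])
  have Dkd: "?T (d_elt i) (kd r m b) = of_int (m $ i) *\<^sub>C kd r m b" for i r m b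
    by (simp add: kd_def clinear_sum[OF T1] Tscale bracket_d_K[OF br form] complex_vector.scale_sum_right mult.commute)
  note D = bracket_d_loop[OF br form] bracket_d_K[OF br form]
  have D': "?T (loop_elt x k b) (d_elt i) = - of_int (k $ i) *\<^sub>C loop_elt x k b"
    "?T (K_elt k j b) (d_elt i) = - of_int (k $ i) *\<^sub>C K_elt k j b" for x k b i j
    using D[where i = i and k = k]
    by (simp_all add: loop_elt_def K_elt_def bracket_d[OF br form] scaleC_Pair complex_vector.scale_minus_left)
  have Tneg: "?T X (- Y) = - ?T X Y" "?T (- X) Y = - ?T X Y" for X Y
    using clinear_scale[OF T1, of X "-1" Y] clinear_scale[OF T2, of "-1" X Y]
    by (simp_all add: complex_vector.scale_minus_left)
  note gens = LL Lkd Dkd D D' bracket_K[OF br form] bracket_d_d[OF br form] Tadd Tscale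
    clinear_0[OF T1] clinear_0[OF T2]
  have skew: "?T X Y + ?T Y X = 0" for X Y
  proof -
    have c: "clinear (\<lambda>X. ?T X Y + ?T Y X)" "clinear (\<lambda>Y. ?T X Y + ?T Y X)" for X Y
      by (rule clinearI; simp add: Tadd Tscale complex_vector.scale_right_distrib)+
    have LLs: "?T (loop_elt x k b) (loop_elt y r b') + ?T (loop_elt y r b') (loop_elt x k b) = 0" for x k b y r b'
    proof -
      have e: "r + k = k + r" "b' * b = b * b'" "form y x = form x y"
        by (simp_all add: add.commute mult.commute sym)
      have "?T (loop_elt x k b) (loop_elt y r b') + ?T (loop_elt y r b') (loop_elt x k b) =
        loop_elt (br x y + br y x) (k + r) (b * b') + form x y *\<^sub>C kd (k + r) (k + r) (b * b')"
        unfolding LL e loop_add[symmetric] kd_add complex_vector.scale_right_distrib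
        by (simp only: add_ac)
      moreover have "br x y + br y x = 0" by (subst skew_g) simp
      ultimately show ?thesis
        by (simp only: kd_self clinear_0[OF loop] complex_vector.scale_zero_right add_0_right)
    qed
    show ?thesis
      by (rule tau_generators[OF c(1)]; rule tau_generators[OF c(2)])
         (simp_all only: LLs, simp_all add: gens complex_vector.scale_minus_left)
  qed
  have alt': "?T X X = 0" for X
  proof -
    have "2 *\<^sub>C ?T X X = ?T X X + ?T X X"
      using complex_vector.scale_left_distrib[of 1 1 "?T X X"] by simp
    then have "2 *\<^sub>C ?T X X = 0" using skew[of X X] by simp
    then show ?thesis by simp
  qed
  define J where "J X Y Z = ?T X (?T Y Z) + ?T Y (?T Z X) + ?T Z (?T X Y)" for X Y Z
  have J: "clinear (\<lambda>X. J X Y Z)" "clinear (\<lambda>Y. J X Y Z)" "clinear (\<lambda>Z. J X Y Z)" for X Y Z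
    unfolding J_def
    by (rule clinearI; simp add: Tadd Tscale complex_vector.scale_right_distrib algebra_simps)+
  have JLLL: "J (loop_elt x k a) (loop_elt y r b) (loop_elt z s c) = 0" for x k a y r b z s c
  proof -
    have c: "form z (br x y) = form x (br y z)" for x y z
      by (subst sym) (rule inv)
    have cyc: "form y (br z x) = form x (br y z)" "form z (br x y) = form x (br y z)"
      by (simp_all only: c[of z x y] c[of x y z])
    have e: "r + (s + k) = k + (r + s)" "s + (k + r) = k + (r + s)"
      "b * (c * a) = a * (b * c)" "c * (a * b) = a * (b * c)"
      by (simp_all add: ac_simps)
    have "J (loop_elt x k a) (loop_elt y r b) (loop_elt z s c) =
      loop_elt (br x (br y z) + br y (br z x) + br z (br x y)) (k + (r + s)) (a * (b * c))
       + form x (br y z) *\<^sub>C kd (k + (r + s)) (k + (r + s)) (a * (b * c))"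
      unfolding J_def LL Tadd Tscale Lkd cyc e kd_add loop_add[symmetric]
        complex_vector.scale_right_distrib complex_vector.scale_zero_right add_0_right
      by (simp only: add_ac)
    then show ?thesis by (simp only: jac kd_self clinear_0[OF loop] complex_vector.scale_zero_right add_0_right)
  qed
  have JLLD: "J (loop_elt x k a) (loop_elt y r b) (d_elt i) = 0" for x k a y r b i
  proof -
    let ?L = "?T (loop_elt x k a) (loop_elt y r b)"
    have 1: "?T (d_elt i) ?L = of_int ((k + r) $ i) *\<^sub>C ?L"
      by (simp add: LL Tadd Tscale D Dkd complex_vector.scale_right_distrib mult.commute)
    have 2: "?T (loop_elt y r b) (loop_elt x k a) = - ?L"
      using skew[of "loop_elt y r b" "loop_elt x k a"] by (simp only: eq_neg_iff_add_eq_0)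
    show ?thesis
      unfolding J_def 1 D' D Tscale 2
      by (simp add: complex_vector.scale_left_distrib)
  qed
  have cyc: "J X Y Z = J Y Z X" for X Y Z
    by (simp add: J_def add_ac)
  have JLDL: "J (loop_elt x k a) (d_elt i) (loop_elt y r b) = 0"
    "J (d_elt i) (loop_elt x k a) (loop_elt y r b) = 0" for x k a y r b i
    by (simp_all only: cyc[of _ "d_elt i"] cyc[of "d_elt i"] JLLD)
  have J0: "J X Y Z = 0" for X Y Z
  proof (rule tau_generators[OF J(1)]; rule tau_generators[OF J(2)]; rule tau_generators[OF J(3)])
  qed (simp_all only: JLLL JLLD JLDL, simp_all add: J_def gens Tneg complex_vector.scale_minus_left mult.commute)
  then show ?thesis
    using bil alt' by (auto simp: lie_algebra_def J_def)
qed

end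

theory Submission
  imports Defs "HOL-Computational_Algebra.Fundamental_Theorem_Algebra"
begin

text \<open>
  Fix one of the directions \<open>1, \<dots>, n\<close>, with variable \<open>t\<close> and central element \<open>K\<close>. The elements
  \<open>K \<otimes> b\<close> commute with everything and preserve the finite dimensional weight spaces, so Schur's lemma
  (\<open>irreducible_module_scalar\<close>) makes them act by scalars \<open>c b\<close>, where \<open>c 1 = 0\<close>. The claim is
  \<open>c = 0\<close>.

  If the simple Lie algebra \<open>g\<close> acts by zero, so do all loops and their commutators, among them the
  \<open>K \<otimes> b\<close> (\<open>trivial_action_central\<close>). Otherwise \<open>g\<close> acts faithfully. The Cartan subalgebra acts
  diagonalizably on the module, so faithfulness makes it abelian and its adjoint action
  diagonalizable. Hence \<open>g\<close> is spanned by root vectors, and since root vectors act locally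
  nilpotently there is an \<open>sl\<^sub>2\<close>-triple \<open>(e, f, h\<^sub>\<alpha>)\<close> of root vectors for roots \<open>\<alpha>\<close>, \<open>-\<alpha>\<close> with
  \<open>\<kappa> = (e, f) \<noteq> 0\<close> (\<open>sl2_triple\<close>).

  Let \<open>W k m\<close> be the weight space for \<open>\<lambda> + k \<alpha> + m \<delta>\<close>, where \<open>\<lambda>\<close> is a weight and \<open>\<delta>\<close> the degree in
  \<open>t\<close>. The nonzero \<open>W k m\<close> have bounded \<open>k\<close>: for \<open>m = 0\<close> because the finite dimensional \<open>W 0 0\<close> meets
  only finitely many of the \<open>sl\<^sub>2\<close>-strings through the \<open>W k 0\<close>, and for any \<open>m\<close> because
  \<open>f \<otimes> t\<^sup>-\<^sup>m\<close> is injective on positive weights and maps \<open>W k m\<close> into \<open>W (k - 1) 0\<close>. This uses that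
  \<open>K\<close> acts by zero, since then all the triples \<open>(e \<otimes> t\<^sup>m, f \<otimes> t\<^sup>-\<^sup>m)\<close> have the same coroot
  \<open>h\<^sub>\<alpha>\<close>.

  Take \<open>v \<noteq> 0\<close> in some \<open>W k m\<close> with \<open>k\<close> maximal; then all \<open>e \<otimes> t\<^sup>m \<otimes> b\<close> kill \<open>v\<close>. For each \<open>m\<close> the spaces
  \<open>e \<otimes> t\<^sup>m \<otimes> B\<close> and \<open>f \<otimes> t\<^sup>-\<^sup>m \<otimes> B\<close> generate a copy of \<open>sl\<^sub>2 \<otimes> B\<close> in which \<open>h\<^sub>\<alpha> \<otimes> b\<close> is replaced by
  \<open>h\<^sub>\<alpha> \<otimes> b + m \<kappa> K \<otimes> b\<close>, and \<open>v\<close> is a highest weight vector whose weight under \<open>h\<^sub>\<alpha>\<close> does not depend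
  on \<open>m\<close>. Reflecting weights gives one exponent \<open>n\<close> with \<open>(f \<otimes> t\<^sup>-\<^sup>m \<otimes> a)\<^sup>n v = 0\<close> for all
  \<open>m\<close>. Applying \<open>(e \<otimes> t\<^sup>m)\<^sup>n\<close> produces a vector valued polynomial in \<open>m\<close> which vanishes identically and
  has the leading term \<open>n! (m \<kappa> c(a))\<^sup>n v\<close> (\<open>central_charge_zero\<close>). Hence \<open>c(a) = 0\<close>.
\<close>

section \<open>Linear operators on finite dimensional spaces\<close>

lemma clinear_neg: "clinear f \<Longrightarrow> f (- x) = - f x"
  using clinear_diff[of f 0 x] by (simp add: clinear_0)

lemma clinear_funpow:
  fixes T :: "'v::complex_vector \<Rightarrow> 'v"
  shows "clinear T \<Longrightarrow> clinear (T ^^ n)"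
  by (induction n) (auto intro!: clinearI simp: clinear_add clinear_scale)

definition poly_apply :: "complex poly \<Rightarrow> ('v \<Rightarrow> 'v) \<Rightarrow> 'v \<Rightarrow> 'v::complex_vector"
  where "poly_apply p T x = (\<Sum>i\<le>degree p. coeff p i *\<^sub>C (T ^^ i) x)"

lemma poly_apply_bound:
  assumes "degree p \<le> n"
  shows "poly_apply p T x = (\<Sum>i\<le>n. coeff p i *\<^sub>C (T ^^ i) x)"
  unfolding poly_apply_def
  by (rule sum.mono_neutral_left) (use assms in \<open>auto simp: coeff_eq_0 not_le\<close>)

lemma poly_apply_linear_factor:
  assumes "clinear T"
  shows "poly_apply ([:-a, 1:] * q) T x = T (poly_apply q T x) - a *\<^sub>C poly_apply q T x"
proof -
  let ?n = "degree q"
  have "degree ([:-a, 1:] * q) \<le> Suc ?n"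
    using degree_mult_le[of "[:-a, 1:]" q] by simp
  then have "poly_apply ([:-a, 1:] * q) T x =
      (\<Sum>i\<le>Suc ?n. coeff (pCons 0 q) i *\<^sub>C (T ^^ i) x - (a * coeff q i) *\<^sub>C (T ^^ i) x)"
    by (subst poly_apply_bound) (auto simp: complex_vector.scale_left_diff_distrib algebra_simps intro!: sum.cong)
  also have "\<dots> = (\<Sum>i\<le>Suc ?n. coeff (pCons 0 q) i *\<^sub>C (T ^^ i) x) - a *\<^sub>C (\<Sum>i\<le>Suc ?n. coeff q i *\<^sub>C (T ^^ i) x)"
    by (simp only: sum_subtractf complex_vector.scale_sum_right complex_vector.scale_scale)
  also have "(\<Sum>i\<le>Suc ?n. coeff (pCons 0 q) i *\<^sub>C (T ^^ i) x) = T (poly_apply q T x)"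
    unfolding sum.atMost_Suc_shift poly_apply_def
    by (simp add: clinear_sum[OF assms] clinear_scale[OF assms])
  also have "(\<Sum>i\<le>Suc ?n. coeff q i *\<^sub>C (T ^^ i) x) = poly_apply q T x"
    by (rule poly_apply_bound[symmetric]) simp
  finally show ?thesis .
qed

lemma poly_apply_mem:
  assumes "complex_vector.subspace W" "\<And>x. x \<in> W \<Longrightarrow> T x \<in> W" "x \<in> W"
  shows "poly_apply p T x \<in> W"
proof -
  have "(T ^^ i) x \<in> W" for i by (induction i) (use assms in auto)
  then show ?thesis
    unfolding poly_apply_def
    by (intro complex_vector.subspace_sum complex_vector.subspace_scale assms)
qed

lemma annihilating_poly:
  assumes "finite S" "\<And>i. (T ^^ i) x \<in> complex_vector.span S"
  shows "\<exists>p. p \<noteq> 0 \<and> poly_apply p T x = 0"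
proof (cases "inj_on (\<lambda>i. (T ^^ i) x) {..card S}")
  case True
  let ?f = "\<lambda>i. (T ^^ i) x"
  have "complex_vector.dependent (?f ` {..card S})"
  proof (rule ccontr)
    assume "\<not> complex_vector.dependent (?f ` {..card S})"
    from complex_vector.independent_span_bound[OF assms(1) this]
    have "card (?f ` {..card S}) \<le> card S" using assms(2) by auto
    then show False by (simp add: card_image[OF True])
  qed
  then obtain u where u: "\<exists>v\<in>?f ` {..card S}. u v \<noteq> 0" "(\<Sum>v\<in>?f ` {..card S}. u v *\<^sub>C v) = 0"
    by (auto simp: complex_vector.dependent_finite)
  define p where "p = (\<Sum>i\<le>card S. monom (u (?f i)) i)"
  have c: "coeff p j = (if j \<le> card S then u (?f j) else 0)" for j
    by (simp add: p_def coeff_sum sum.delta)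
  have "degree p \<le> card S"
    by (rule degree_le) (simp add: c)
  then have "poly_apply p T x = (\<Sum>i\<le>card S. u (?f i) *\<^sub>C ?f i)"
    by (subst poly_apply_bound) (auto simp: c)
  also have "\<dots> = 0"
    using u(2) by (simp add: sum.reindex[OF True])
  finally have "poly_apply p T x = 0" .
  moreover have "p \<noteq> 0"
    using u(1) c by (metis (no_types, lifting) atMost_iff coeff_0 image_iff)
  ultimately show ?thesis by blast
next
  case False
  then obtain i j where ij: "(T ^^ i) x = (T ^^ j) x" "i \<noteq> j" by (auto simp: inj_on_def)
  let ?p = "monom (1::complex) i - monom 1 j"
  have "degree ?p \<le> max i j"
    by (rule degree_le) (auto)
  then have "poly_apply ?p T x = (\<Sum>k\<le>max i j. coeff ?p k *\<^sub>C (T ^^ k) x)"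
    by (rule poly_apply_bound)
  also have "\<dots> = (\<Sum>k\<le>max i j. (if k = i then (T ^^ i) x else 0) - (if k = j then (T ^^ j) x else 0))"
    by (rule sum.cong) (auto simp: complex_vector.scale_left_diff_distrib)
  also have "\<dots> = 0"
    by (simp add: sum_subtractf ij)
  finally have "poly_apply ?p T x = 0" .
  moreover have "coeff ?p i \<noteq> 0" using ij(2) by simp
  then have "?p \<noteq> 0" by (metis coeff_0)
  ultimately show ?thesis by blast
qed

text \<open>An eigenvector of the operator induced on \<open>W / E\<close>. For \<open>E = {0}\<close> this is the existence of
  eigenvectors. Among the nonzero polynomials \<open>p\<close> with \<open>p(T) x \<in> E\<close> take one of least degree and
  split off a linear factor.\<close>

lemma eigenvector_modulo_subspace:
  assumes T: "clinear T" and W: "complex_vector.subspace W" "\<And>x. x \<in> W \<Longrightarrow> T x \<in> W"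
    and fin: "finite S" "W \<subseteq> complex_vector.span S"
    and E: "complex_vector.subspace E" and x: "x \<in> W" "x \<notin> E"
  shows "\<exists>z a. z \<in> W \<and> z \<notin> E \<and> T z - a *\<^sub>C z \<in> E"
proof -
  have "(T ^^ i) x \<in> W" for i by (induction i) (use x(1) W(2) in auto)
  then obtain p0 where p0: "p0 \<noteq> 0" "poly_apply p0 T x = 0"
    using annihilating_poly[OF fin(1), of T x] fin(2) by blast
  define P where "P p \<longleftrightarrow> p \<noteq> 0 \<and> poly_apply p T x \<in> E" for p
  have "P p0" using p0 complex_vector.subspace_0[OF E] by (simp add: P_def)
  then obtain p where p: "P p" "\<And>q. P q \<Longrightarrow> degree p \<le> degree q"
    using ex_has_least_nat[of P p0 degree] by auto
  have "degree p \<noteq> 0"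
  proof
    assume d: "degree p = 0"
    then obtain c where c: "p = [:c:]" by (rule degree_eq_zeroE)
    then have "c \<noteq> 0" "c *\<^sub>C x \<in> E" using p(1) by (auto simp: P_def poly_apply_def)
    then have "inverse c *\<^sub>C (c *\<^sub>C x) \<in> E" using complex_vector.subspace_scale[OF E] by blast
    then show False using x(2) \<open>c \<noteq> 0\<close> by simp
  qed
  then have "\<not> constant (poly p)" by (simp add: constant_degree)
  then obtain a where "poly p a = 0" using fundamental_theorem_of_algebra by blast
  then obtain q where q: "p = [:-a, 1:] * q" by (auto simp: poly_eq_0_iff_dvd dvd_def)
  have "q \<noteq> 0" using p(1) q by (auto simp: P_def)
  then have "degree q < degree p" by (simp add: q degree_mult_eq del: mult_pCons_left)
  then have "poly_apply q T x \<notin> E" using p(2)[of q] \<open>q \<noteq> 0\<close> by (auto simp: P_def)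
  moreover have "poly_apply q T x \<in> W" by (rule poly_apply_mem[OF W x(1)])
  moreover have "T (poly_apply q T x) - a *\<^sub>C poly_apply q T x \<in> E"
    using p(1) poly_apply_linear_factor[OF T, of a q x] by (simp add: P_def q)
  ultimately show ?thesis by blast
qed

text \<open>The last hypothesis excludes Jordan blocks of size two. If the eigenvectors did not span, an
  eigenvector \<open>z\<close> modulo their span could be corrected by eigenvectors to a generalized, hence to a
  genuine eigenvector.\<close>

lemma span_eigenvectors:
  assumes T: "clinear T" and W: "complex_vector.subspace W" "\<And>x. x \<in> W \<Longrightarrow> T x \<in> W"
    and fin: "finite S" "W \<subseteq> complex_vector.span S"
    and semisimple: "\<And>x a. x \<in> W \<Longrightarrow> T (T x - a *\<^sub>C x) = a *\<^sub>C (T x - a *\<^sub>C x) \<Longrightarrow> T x = a *\<^sub>C x"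
  shows "W \<subseteq> complex_vector.span {x\<in>W. \<exists>a. T x = a *\<^sub>C x}"
proof (rule ccontr)
  let ?X = "{x\<in>W. \<exists>a. T x = a *\<^sub>C x}"
  let ?E = "complex_vector.span ?X"
  assume "\<not> W \<subseteq> ?E"
  then obtain x where x: "x \<in> W" "x \<notin> ?E" by auto
  obtain z a where z: "z \<in> W" "z \<notin> ?E" "T z - a *\<^sub>C z \<in> ?E"
    using eigenvector_modulo_subspace[OF T W fin complex_vector.subspace_span x] by blast
  have EW: "?E \<subseteq> W" by (rule complex_vector.span_minimal) (use W in auto)
  \<comment> \<open>On the span of the eigenvectors for eigenvalues other than \<open>a\<close> the operator \<open>T - a\<close> is onto;
    the remaining part of \<open>T z - a z\<close> is an eigenvector for \<open>a\<close>.\<close>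
  have "\<exists>y\<in>?E. \<exists>u. u \<in> W \<and> T u = a *\<^sub>C u \<and> w = T y - a *\<^sub>C y + u" if "w \<in> ?E" for w
    using that
  proof (induction w rule: complex_vector.span_induct)
    case base
    show ?case
      unfolding complex_vector.subspace_def
    proof (intro conjI ballI allI)
      show "0 \<in> {w. \<exists>y\<in>?E. \<exists>u. u \<in> W \<and> T u = a *\<^sub>C u \<and> w = T y - a *\<^sub>C y + u}"
        by (auto intro!: bexI[of _ 0] exI[of _ 0] simp: clinear_0[OF T] complex_vector.span_zero complex_vector.subspace_0[OF W(1)])
    next
      fix w w'
      assume "w \<in> {w. \<exists>y\<in>?E. \<exists>u. u \<in> W \<and> T u = a *\<^sub>C u \<and> w = T y - a *\<^sub>C y + u}"
        and "w' \<in> {w. \<exists>y\<in>?E. \<exists>u. u \<in> W \<and> T u = a *\<^sub>C u \<and> w = T y - a *\<^sub>C y + u}"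
      then obtain y u y' u' where "y \<in> ?E" "u \<in> W" "T u = a *\<^sub>C u" "w = T y - a *\<^sub>C y + u"
        "y' \<in> ?E" "u' \<in> W" "T u' = a *\<^sub>C u'" "w' = T y' - a *\<^sub>C y' + u'" by auto
      then show "w + w' \<in> {w. \<exists>y\<in>?E. \<exists>u. u \<in> W \<and> T u = a *\<^sub>C u \<and> w = T y - a *\<^sub>C y + u}"
        by (intro CollectI bexI[of _ "y + y'"] exI[of _ "u + u'"])
          (auto simp: clinear_add[OF T] complex_vector.scale_right_distrib complex_vector.span_add
            complex_vector.subspace_add[OF W(1)])
    next
      fix c w
      assume "w \<in> {w. \<exists>y\<in>?E. \<exists>u. u \<in> W \<and> T u = a *\<^sub>C u \<and> w = T y - a *\<^sub>C y + u}"
      then obtain y u where "y \<in> ?E" "u \<in> W" "T u = a *\<^sub>C u" "w = T y - a *\<^sub>C y + u" by auto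
      then show "c *\<^sub>C w \<in> {w. \<exists>y\<in>?E. \<exists>u. u \<in> W \<and> T u = a *\<^sub>C u \<and> w = T y - a *\<^sub>C y + u}"
        by (intro CollectI bexI[of _ "c *\<^sub>C y"] exI[of _ "c *\<^sub>C u"])
          (auto simp: clinear_scale[OF T] complex_vector.scale_right_distrib complex_vector.span_scale
            complex_vector.scale_right_diff_distrib complex_vector.subspace_scale[OF W(1)] mult.commute)
    qed
  next
    case (step w)
    then obtain b where b: "w \<in> W" "T w = b *\<^sub>C w" by auto
    show ?case
    proof (cases "b = a")
      case True
      then show ?thesis
        using b by (auto intro!: bexI[of _ 0] exI[of _ w] simp: clinear_0[OF T] complex_vector.span_zero)
    next
      case False
      let ?c = "inverse (b - a)"
      have "w = (b * ?c - a * ?c) *\<^sub>C w"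
        unfolding left_diff_distrib[symmetric] using False by simp
      also have "\<dots> = T (?c *\<^sub>C w) - a *\<^sub>C ?c *\<^sub>C w"
        unfolding clinear_scale[OF T] b(2) complex_vector.scale_left_diff_distrib
        by (simp add: mult.commute)
      finally show ?thesis
        using step
        by (intro bexI[of _ "inverse (b - a) *\<^sub>C w"] exI[of _ 0])
          (auto simp: clinear_0[OF T] complex_vector.subspace_0[OF W(1)] intro: complex_vector.span_scale complex_vector.span_base)
    qed
  qed
  from this[OF z(3)] obtain y u where yu: "y \<in> ?E" "T u = a *\<^sub>C u" "T z - a *\<^sub>C z = T y - a *\<^sub>C y + u" by blast
  then have "T (z - y) - a *\<^sub>C (z - y) = u"
    by (simp add: clinear_diff[OF T] complex_vector.scale_right_diff_distrib algebra_simps)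
  moreover have "z - y \<in> W" using z(1) yu(1) EW complex_vector.subspace_diff[OF W(1)] by blast
  ultimately have "T (z - y) = a *\<^sub>C (z - y)"
    using semisimple[of "z - y" a] yu(2) by simp
  then have "z - y \<in> ?E" using \<open>z - y \<in> W\<close> by (intro complex_vector.span_base) auto
  then have "z - y + y \<in> ?E" using yu(1) complex_vector.span_add by blast
  then show False using z(2) by simp
qed

text \<open>Joint eigenspaces of some of the operators are invariant under the others, so they can be
  decomposed further, one operator at a time.\<close>

lemma span_joint_eigenvectors:
  fixes A :: "('v::complex_vector \<Rightarrow> 'v) set"
  assumes "finite A" and fin: "finite S" "complex_vector.span S = (UNIV :: 'v set)"
    and lin: "\<And>T. T \<in> A \<Longrightarrow> clinear T"
    and comm: "\<And>T T' x. T \<in> A \<Longrightarrow> T' \<in> A \<Longrightarrow> T (T' x) = T' (T x)"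
    and semisimple: "\<And>T x a. T \<in> A \<Longrightarrow> T (T x - a *\<^sub>C x) = a *\<^sub>C (T x - a *\<^sub>C x) \<Longrightarrow> T x = a *\<^sub>C x"
  shows "complex_vector.span {x. \<forall>T\<in>A. \<exists>a. T x = a *\<^sub>C x} = UNIV"
  using assms(1) lin comm semisimple
proof (induction A rule: finite_induct)
  case empty
  show ?case by simp
next
  case (insert T A)
  let ?J = "\<lambda>A. {x :: 'v. \<forall>T\<in>A. \<exists>a. T x = a *\<^sub>C x}"
  have T: "clinear T" using insert.prems(1) by blast
  have "x \<in> complex_vector.span (?J (insert T A))" if "x \<in> ?J A" for x
  proof -
    from that obtain a where a: "T' x = a T' *\<^sub>C x" if "T' \<in> A" for T'
      by simp metis
    let ?W = "{z. \<forall>T'\<in>A. T' z = a T' *\<^sub>C z}"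
    have W: "complex_vector.subspace ?W"
      using insert.prems(1)
      by (auto simp: complex_vector.subspace_def clinear_0 clinear_add clinear_scale
          complex_vector.scale_right_distrib mult.commute)
    have TW: "T z \<in> ?W" if "z \<in> ?W" for z
    proof (clarsimp)
      fix T' assume "T' \<in> A"
      have "T' (T z) = T (T' z)" using insert.prems(2) \<open>T' \<in> A\<close> by blast
      also have "T' z = a T' *\<^sub>C z" using that \<open>T' \<in> A\<close> by blast
      finally show "T' (T z) = a T' *\<^sub>C T z" by (simp only: clinear_scale[OF T])
    qed
    have "?W \<subseteq> complex_vector.span {z\<in>?W. \<exists>b. T z = b *\<^sub>C z}"
    proof (rule span_eigenvectors[OF T W TW fin(1)])
      show "?W \<subseteq> complex_vector.span S" by (simp add: fin(2))
      show "T x = b *\<^sub>C x" if "T (T x - b *\<^sub>C x) = b *\<^sub>C (T x - b *\<^sub>C x)" for x b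
        using insert.prems(3)[OF insertI1 that] .
    qed
    also have "\<dots> \<subseteq> complex_vector.span (?J (insert T A))"
      by (rule complex_vector.span_mono) auto
    finally show ?thesis using a by auto
  qed
  then have "complex_vector.span (?J A) \<subseteq> complex_vector.span (?J (insert T A))"
    by (intro complex_vector.span_minimal) auto
  moreover have "complex_vector.span (?J A) = UNIV"
  proof (rule insert.IH)
    show "T' (T'' x) = T'' (T' x)" if "T' \<in> A" "T'' \<in> A" for T' T'' x
      by (rule insert.prems(2)[OF insertI2[OF that(1)] insertI2[OF that(2)]])
    show "T' x = a *\<^sub>C x" if "T' \<in> A" "T' (T' x - a *\<^sub>C x) = a *\<^sub>C (T' x - a *\<^sub>C x)" for T' x a
      by (rule insert.prems(3)[OF insertI2[OF that(1)] that(2)])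
  qed (rule insert.prems(1)[OF insertI2])
  ultimately show ?case by auto
qed

text \<open>A linear functional that is nonzero on the top coefficient reduces this to complex polynomials
  with infinitely many roots.\<close>

lemma vanishing_polynomial_top_coeff:
  fixes w :: "nat \<Rightarrow> 'v::complex_vector"
  assumes "\<And>m. (\<Sum>j\<le>n. of_nat m ^ j *\<^sub>C w j) = 0"
  shows "w n = 0"
proof (rule ccontr)
  assume "w n \<noteq> 0"
  then have ind: "complex_vector.independent {w n}" by simp
  define B where "B = complex_vector.extend_basis {w n}"
  have B: "complex_vector.independent B" "complex_vector.span B = UNIV" "w n \<in> B"
    using complex_vector.independent_extend_basis[OF ind] complex_vector.span_extend_basis[OF ind]
      complex_vector.extend_basis_superset[OF ind] by (auto simp: B_def)
  define \<phi> where "\<phi> x = complex_vector.representation B x (w n)" for x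
  have \<phi>: "clinear \<phi>"
    by (rule clinearI) (simp_all add: \<phi>_def complex_vector.representation_add[OF B(1)]
        complex_vector.representation_scale[OF B(1)] B(2) scaleC_complex_def)
  define p where "p = (\<Sum>j\<le>n. monom (\<phi> (w j)) j)"
  have "poly p (of_nat m) = \<phi> (\<Sum>j\<le>n. of_nat m ^ j *\<^sub>C w j)" for m
    by (simp add: p_def poly_sum poly_monom clinear_sum[OF \<phi>] clinear_scale[OF \<phi>] scaleC_complex_def mult.commute)
  then have "poly p (of_nat m) = 0" for m
    by (simp add: assms clinear_0[OF \<phi>])
  then have "range (of_nat :: nat \<Rightarrow> complex) \<subseteq> {x. poly p x = 0}" by auto
  moreover have "infinite (range (of_nat :: nat \<Rightarrow> complex))"
    by (rule range_inj_infinite) (simp add: inj_def)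
  ultimately have "p = 0" using poly_roots_finite finite_subset by blast
  moreover have "coeff p n = \<phi> (w n)"
    by (simp add: p_def coeff_sum)
  moreover have "\<phi> (w n) = 1"
    by (simp add: \<phi>_def complex_vector.representation_basis[OF B(1) B(3)])
  ultimately show False by simp
qed


section \<open>Strings of weight vectors\<close>

definition locally_nilpotent :: "('v::complex_vector \<Rightarrow> 'v) \<Rightarrow> bool"
  where "locally_nilpotent f \<longleftrightarrow> (\<forall>v. \<exists>n. (f ^^ n) v = 0)"

text \<open>The relations \<open>[e, f] = h\<close>, \<open>[h, e] = a e\<close>, \<open>[h, f] = - a f\<close> between operators: \<open>sl\<^sub>2\<close> for \<open>a = 2\<close>,
  a Heisenberg algebra for \<open>a = 0\<close>.\<close>

definition string_relations :: "complex \<Rightarrow> ('v::complex_vector \<Rightarrow> 'v) \<Rightarrow> ('v \<Rightarrow> 'v) \<Rightarrow> ('v \<Rightarrow> 'v) \<Rightarrow> bool"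
  where "string_relations a e f h \<longleftrightarrow> clinear e \<and> clinear f \<and> clinear h \<and>
     (\<forall>v. e (f v) = f (e v) + h v) \<and> (\<forall>v. h (e v) = e (h v) + a *\<^sub>C e v) \<and> (\<forall>v. h (f v) = f (h v) - a *\<^sub>C f v)"

lemma string_relations_swap:
  assumes "string_relations a e f h"
  shows "string_relations a f e (\<lambda>v. - h v)"
proof -
  have h: "clinear h" using assms by (simp add: string_relations_def)
  have "clinear (\<lambda>v. - h v)"
    by (rule clinearI) (simp_all add: clinear_add[OF h] clinear_scale[OF h] complex_vector.scale_minus_right)
  moreover have "e (- h v) = - e (h v)" "f (- h v) = - f (h v)" for v
    using assms clinear_diff[of e 0 "h v"] clinear_diff[of f 0 "h v"]
    by (simp_all add: string_relations_def clinear_0)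
  ultimately show ?thesis
    using assms by (simp add: string_relations_def)
qed

lemma last_nonzero_power:
  assumes "locally_nilpotent f" "v \<noteq> 0"
  shows "\<exists>n. (f ^^ n) v \<noteq> 0 \<and> f ((f ^^ n) v) = 0"
proof -
  obtain N where N: "(f ^^ N) v = 0" using assms(1) by (auto simp: locally_nilpotent_def)
  define M where "M = (LEAST N. (f ^^ N) v = 0)"
  have M: "(f ^^ M) v = 0" unfolding M_def by (rule LeastI, rule N)
  then have "M \<noteq> 0" using assms(2) by (cases M) auto
  then obtain n where n: "M = Suc n" by (cases M) auto
  have "(f ^^ n) v \<noteq> 0" using not_less_Least[of n "\<lambda>N. (f ^^ N) v = 0"] n by (simp add: M_def)
  moreover have "f ((f ^^ n) v) = 0" using M by (simp add: n)
  ultimately show ?thesis by blast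
qed

lemma raising_string_weight:
  assumes "string_relations a e f h" "h v = q *\<^sub>C v"
  shows "h ((e ^^ n) v) = (q + of_nat n * a) *\<^sub>C (e ^^ n) v"
proof (induction n)
  case (Suc n)
  let ?w = "(e ^^ n) v"
  have "h (e ?w) = e ((q + of_nat n * a) *\<^sub>C ?w) + a *\<^sub>C e ?w"
    using assms(1) unfolding string_relations_def Suc.IH[symmetric] by blast
  also have "\<dots> = (q + of_nat n * a) *\<^sub>C e ?w + a *\<^sub>C e ?w"
    using assms(1) clinear_scale[of e] unfolding string_relations_def by metis
  also have "\<dots> = (q + of_nat (Suc n) * a) *\<^sub>C e ?w"
    by (simp add: algebra_simps)
  finally show ?case by simp
qed (use assms in simp)

lemma lowering_string_weight:
  assumes "string_relations a e f h" "h v = q *\<^sub>C v"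
  shows "h ((f ^^ n) v) = (q - of_nat n * a) *\<^sub>C (f ^^ n) v"
proof -
  have "- h v = (- q) *\<^sub>C v" using assms(2) by simp
  from raising_string_weight[OF string_relations_swap[OF assms(1)] this, of n]
  have "h ((f ^^ n) v) = - ((- q + of_nat n * a) *\<^sub>C (f ^^ n) v)" by (metis minus_minus)
  then show ?thesis by (simp flip: complex_vector.scale_minus_left)
qed

lemma raise_lowering_string:
  assumes r: "string_relations a e f h" and "e v = 0" "h v = q *\<^sub>C v"
  shows "e ((f ^^ Suc n) v) = (of_nat (Suc n) * (q - of_nat n * a / 2)) *\<^sub>C (f ^^ n) v"
proof (induction n)
  case 0
  have "clinear f" "e (f v) = f (e v) + h v" using r by (auto simp: string_relations_def)
  then show ?case using assms(2,3) by (simp add: clinear_0)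
next
  case (Suc n)
  have f: "clinear f" and ef: "\<And>v. e (f v) = f (e v) + h v" using r by (auto simp: string_relations_def)
  let ?w = "(f ^^ Suc n) v"
  have "e (f ?w) = f (e ?w) + h ?w" by (rule ef)
  also have "f (e ?w) = (of_nat (Suc n) * (q - of_nat n * a / 2)) *\<^sub>C ?w"
    by (simp only: Suc.IH clinear_scale[OF f]) simp
  also have "h ?w = (q - of_nat (Suc n) * a) *\<^sub>C ?w"
    by (rule lowering_string_weight[OF r assms(3)])
  finally have "e (f ?w) = (of_nat (Suc n) * (q - of_nat n * a / 2) + (q - of_nat (Suc n) * a)) *\<^sub>C ?w"
    by (simp only: complex_vector.scale_left_distrib)
  also have "of_nat (Suc n) * (q - of_nat n * a / 2) + (q - of_nat (Suc n) * a)
      = of_nat (Suc (Suc n)) * (q - of_nat (Suc n) * a / 2)"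
    by (simp add: field_simps)
  finally show ?case by simp
qed

text \<open>For \<open>a = 2\<close> the highest weight is a natural number; for \<open>a = 0\<close> it is zero, which is how
  degenerate triples are excluded below.\<close>

lemma highest_weight_values:
  assumes r: "string_relations a e f h" and v: "e v = 0" "h v = q *\<^sub>C v" "v \<noteq> 0"
    and nil: "locally_nilpotent f"
  shows "\<exists>n. q = of_nat n * a / 2"
proof -
  obtain n where n: "(f ^^ n) v \<noteq> 0" "f ((f ^^ n) v) = 0"
    using last_nonzero_power[OF nil v(3)] by blast
  have "clinear e" using r by (simp add: string_relations_def)
  then have "(of_nat (Suc n) * (q - of_nat n * a / 2)) *\<^sub>C (f ^^ n) v = 0"
    using raise_lowering_string[OF r v(1,2), of n] n(2) by (simp add: clinear_0)
  then have "of_nat (Suc n) * (q - of_nat n * a / 2) = 0"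
    using n(1) by simp
  then show ?thesis
    using of_nat_neq_0[of n, where 'a = complex] by (intro exI[of _ n]) (simp del: of_nat_Suc)
qed

text \<open>The strings of different highest weight vectors in one weight space are told apart by the powers
  of \<open>e\<close> that they survive; this is what bounds their number.\<close>

lemma raise_lower_power_nonzero:
  assumes r: "string_relations 2 e f h" and v: "e v = 0" "h v = of_nat p *\<^sub>C v" "v \<noteq> 0"
  shows "n \<le> p \<Longrightarrow> (e ^^ n) ((f ^^ n) v) \<noteq> 0"
proof (induction n)
  case (Suc n)
  have e: "clinear e" using r by (simp add: string_relations_def)
  have "(e ^^ Suc n) ((f ^^ Suc n) v) = (e ^^ n) (e ((f ^^ Suc n) v))"
    by (simp only: funpow_Suc_right o_apply)
  also have "\<dots> = (of_nat (Suc n) * (of_nat p - of_nat n)) *\<^sub>C (e ^^ n) ((f ^^ n) v)"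
    unfolding raise_lowering_string[OF r v(1,2)] clinear_scale[OF clinear_funpow[OF e]] by simp
  moreover have "of_nat (Suc n) * (of_nat p - of_nat n :: complex) \<noteq> 0"
    using Suc.prems of_nat_neq_0[of n, where 'a = complex] by (simp del: of_nat_Suc)
  ultimately show ?case using Suc by (simp del: funpow.simps)
qed (use v in simp)

lemma lower_power_nonzero:
  assumes r: "string_relations 2 e f h" and v: "e v = 0" "h v = of_nat p *\<^sub>C v" "v \<noteq> 0" and "n \<le> p"
  shows "(f ^^ n) v \<noteq> 0"
proof
  assume "(f ^^ n) v = 0"
  moreover have "clinear (e ^^ n)" using r by (intro clinear_funpow) (simp add: string_relations_def)
  ultimately show False
    using raise_lower_power_nonzero[OF assms] by (simp add: clinear_0)
qed

lemma weights_integral: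
  assumes r: "string_relations 2 e f h" and nil: "locally_nilpotent e" "locally_nilpotent f"
    and v: "h v = q *\<^sub>C v" "v \<noteq> 0"
  shows "\<exists>p::int. q = of_int p"
proof -
  obtain n where n: "(e ^^ n) v \<noteq> 0" "e ((e ^^ n) v) = 0"
    using last_nonzero_power[OF nil(1) v(2)] by blast
  obtain k where "q + of_nat n * 2 = of_nat k * 2 / 2"
    using highest_weight_values[OF r n(2) raising_string_weight[OF r v(1)] n(1) nil(2)] by blast
  then have "q = of_int (int k - 2 * int n)" by (simp add: algebra_simps)
  then show ?thesis by blast
qed

text \<open>A vector of positive weight killed by \<open>f\<close> would be a lowest weight vector, and those have
  weight \<open>\<le> 0\<close>.\<close>

lemma lower_positive_weight_nonzero:
  assumes r: "string_relations 2 e f h" and nil: "locally_nilpotent e"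
    and v: "h v = of_int p *\<^sub>C v" "v \<noteq> 0" "p > 0"
  shows "f v \<noteq> 0"
proof
  assume "f v = 0"
  moreover have "- h v = (- of_int p) *\<^sub>C v" using v(1) by simp
  ultimately obtain n where "- of_int p = (of_nat n * 2 / 2 :: complex)"
    using highest_weight_values[OF string_relations_swap[OF r] _ _ v(2) nil] by blast
  then have "of_int (- p) = (of_int (int n) :: complex)" by simp
  then show False unfolding of_int_eq_iff using v(3) by simp
qed

text \<open>From a vector of weight \<open>p\<close> one descends to a lowest weight vector and returns to the opposite end
  of its string, which lies at least as far up as the reflection of \<open>p\<close>.\<close>

lemma reflected_weight:
  assumes r: "string_relations 2 e f h" and nil: "locally_nilpotent e" "locally_nilpotent f"
    and v: "h v = of_int p *\<^sub>C v" "v \<noteq> 0"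
  shows "\<exists>i j. int j = 2 * int i - p \<and> (e ^^ j) ((f ^^ i) v) \<noteq> 0"
proof -
  obtain n where n: "(f ^^ n) v \<noteq> 0" "f ((f ^^ n) v) = 0"
    using last_nonzero_power[OF nil(2) v(2)] by blast
  let ?w = "(f ^^ n) v"
  have w: "- h ?w = (of_nat n * 2 - of_int p) *\<^sub>C ?w"
    using lowering_string_weight[OF r v(1), of n] by (simp flip: complex_vector.scale_minus_left)
  then obtain k where k: "of_nat n * 2 - of_int p = (of_nat k * 2 / 2 :: complex)"
    using highest_weight_values[OF string_relations_swap[OF r] n(2) _ n(1) nil(1)] by blast
  then have "of_int (int n * 2 - p) = (of_int (int k) :: complex)" by simp
  then have k': "int k = 2 * int n - p" unfolding of_int_eq_iff by simp
  have "(e ^^ k) ?w \<noteq> 0"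
    by (rule lower_power_nonzero[OF string_relations_swap[OF r] n(2) _ n(1) order_refl]) (use w k in simp)
  then show ?thesis using k' by (intro exI[of _ n] exI[of _ k]) auto
qed

section \<open>Polynomial dependence on the degree shift\<close>

text \<open>The functions \<open>m \<mapsto> F m b\<^sub>1 (\<dots> (F m b\<^sub>s (p m)))\<close> and their linear combinations, where \<open>p\<close> is a
  polynomial in \<open>m\<close> of degree less than \<open>d\<close> with coefficients in \<open>U\<close>. The strict bound makes these
  classes (with \<open>s\<close> lowering operators) the error terms in computations up to lower order in \<open>m\<close>.\<close>

inductive lowered_poly :: "(nat \<Rightarrow> 'b \<Rightarrow> 'v \<Rightarrow> 'v::complex_vector) \<Rightarrow> 'v set \<Rightarrow> nat \<Rightarrow> nat \<Rightarrow> (nat \<Rightarrow> 'v) \<Rightarrow> bool"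
  for F U
  where zero: "lowered_poly F U s d (\<lambda>_. 0)"
  | add: "lowered_poly F U s d g \<Longrightarrow> lowered_poly F U s d g' \<Longrightarrow> lowered_poly F U s d (\<lambda>m. g m + g' m)"
  | scale: "lowered_poly F U s d g \<Longrightarrow> lowered_poly F U s d (\<lambda>m. k *\<^sub>C g m)"
  | monom: "u \<in> U \<Longrightarrow> j < d \<Longrightarrow> lowered_poly F U 0 d (\<lambda>m. of_nat m ^ j *\<^sub>C u)"
  | lower: "lowered_poly F U s d g \<Longrightarrow> lowered_poly F U (Suc s) d (\<lambda>m. F m b (g m))"

lemma lowered_poly_mono: "lowered_poly F U s d g \<Longrightarrow> d \<le> d' \<Longrightarrow> lowered_poly F U s d' g"
  by (induction rule: lowered_poly.induct) (auto intro: lowered_poly.intros)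

lemma lowered_poly_diff:
  assumes "lowered_poly F U s d g" "lowered_poly F U s d g'"
  shows "lowered_poly F U s d (\<lambda>m. g m - g' m)"
  using lowered_poly.add[OF assms(1) lowered_poly.scale[OF assms(2), of "-1"]] by simp

lemma lowered_poly_times_variable:
  assumes F: "\<And>m b. clinear (F m b)" and "lowered_poly F U s d g"
  shows "lowered_poly F U s (Suc d) (\<lambda>m. of_nat m *\<^sub>C g m)"
  using assms(2)
proof (induction rule: lowered_poly.induct)
  case (monom u j d)
  then show ?case using lowered_poly.monom[of u U "Suc j" "Suc d" F] by simp
next
  case (lower s d g b)
  then show ?case using lowered_poly.lower[of F U s "Suc d" "\<lambda>m. of_nat m *\<^sub>C g m" b]
    by (simp add: clinear_scale[OF F])
next
  case (add s d g g')
  then show ?case using lowered_poly.add by (fastforce simp: complex_vector.scale_right_distrib)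
next
  case (scale s d g k)
  then show ?case using lowered_poly.scale[of F U s "Suc d" "\<lambda>m. of_nat m *\<^sub>C g m" k]
    by (simp add: mult.commute)
qed (simp add: lowered_poly.zero)

lemma lowered_poly_times_power:
  assumes F: "\<And>m b. clinear (F m b)" and "lowered_poly F U s d g"
  shows "lowered_poly F U s (k + d) (\<lambda>m. of_nat m ^ k *\<^sub>C g m)"
proof (induction k)
  case (Suc k)
  from lowered_poly_times_variable[OF F Suc] show ?case by simp
qed (use assms(2) in simp)

lemma lowered_poly_0E:
  assumes "lowered_poly F U s d g" "s = 0"
  shows "\<exists>w. \<forall>m. g m = (\<Sum>j<d. of_nat m ^ j *\<^sub>C w j)"
  using assms
proof (induction rule: lowered_poly.induct)
  case (zero s d)
  then show ?case by (auto intro!: exI[of _ "\<lambda>_. 0"])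
next
  case (add s d g g')
  then obtain w w' where "\<forall>m. g m = (\<Sum>j<d. of_nat m ^ j *\<^sub>C w j)" "\<forall>m. g' m = (\<Sum>j<d. of_nat m ^ j *\<^sub>C w' j)" by auto
  then show ?case
    by (auto intro!: exI[of _ "\<lambda>j. w j + w' j"] simp: complex_vector.scale_right_distrib sum.distrib)
next
  case (scale s d g k)
  then obtain w where "\<forall>m. g m = (\<Sum>j<d. of_nat m ^ j *\<^sub>C w j)" by auto
  then show ?case
    by (auto intro!: exI[of _ "\<lambda>j. k *\<^sub>C w j"] simp: complex_vector.scale_sum_right mult.commute)
next
  case (monom u j d)
  have "(\<Sum>i<d. of_nat m ^ i *\<^sub>C (if i = j then u else 0)) = of_nat m ^ j *\<^sub>C u" for m
  proof -
    have "(\<Sum>i<d. of_nat m ^ i *\<^sub>C (if i = j then u else 0)) = (\<Sum>i<d. if i = j then of_nat m ^ j *\<^sub>C u else 0)"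
      by (rule sum.cong) auto
    then show ?thesis using monom by simp
  qed
  then show ?case by (intro exI[of _ "\<lambda>i. if i = j then u else 0"]) metis
qed simp

text \<open>Here \<open>E m\<close> stands for \<open>e \<otimes> t\<^sup>m\<close>, \<open>F m b\<close> for \<open>f \<otimes> t\<^sup>-\<^sup>m \<otimes> b\<close> and \<open>A b\<close> for \<open>h\<^sub>\<alpha> \<otimes> b\<close>. Moving one \<open>E m\<close>
  through a product of lowering operators removes one of them and raises the degree in \<open>m\<close> by at most
  one, and the degree rises only through the central term \<open>m c(b)\<close>. So \<open>E\<^sup>n F\<^sup>n v\<close> has the leading term
  \<open>n! (m c(a))\<^sup>n v\<close>.\<close>

lemma central_charge_zero:
  fixes E :: "nat \<Rightarrow> 'v \<Rightarrow> 'v::complex_vector" and F :: "nat \<Rightarrow> 'b::times \<Rightarrow> 'v \<Rightarrow> 'v"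
    and A :: "'b \<Rightarrow> 'v \<Rightarrow> 'v" and c :: "'b \<Rightarrow> complex"
  assumes E: "\<And>m. clinear (E m)" and F: "\<And>m b. clinear (F m b)" and A: "\<And>b. clinear (A b)"
    and EF: "\<And>m b v. E m (F m b v) = F m b (E m v) + (A b v + (of_nat m * c b) *\<^sub>C v)"
    and AF: "\<And>m b b' v. A b (F m b' v) = F m b' (A b v) - 2 *\<^sub>C F m (b * b') v"
    and EU: "\<And>m u. u \<in> U \<Longrightarrow> E m u = 0" and AU: "\<And>b u. u \<in> U \<Longrightarrow> A b u \<in> U"
    and v: "v \<in> U" "v \<noteq> 0" and nil: "\<And>m. (F m a ^^ n) v = 0"
  shows "c a = 0"
proof -
  let ?G = "lowered_poly F U"
  have G_A: "?G s (Suc d) (\<lambda>m. A b (g m) + (of_nat m * c b) *\<^sub>C g m)" if "?G s d g" for s d g b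
    using that
  proof (induction rule: lowered_poly.induct)
    case (zero s d)
    show ?case by (simp add: clinear_0[OF A] lowered_poly.zero)
  next
    case (add s d g g')
    from lowered_poly.add[OF add.IH] show ?case
      by (simp add: clinear_add[OF A] complex_vector.scale_right_distrib ac_simps)
  next
    case (scale s d g k)
    from lowered_poly.scale[OF scale.IH, of k] show ?case
      by (simp add: clinear_scale[OF A] complex_vector.scale_right_distrib ac_simps)
  next
    case (monom u j d)
    have "?G 0 (Suc d) (\<lambda>m. of_nat m ^ j *\<^sub>C A b u + c b *\<^sub>C of_nat m ^ Suc j *\<^sub>C u)"
      by (intro lowered_poly.add lowered_poly.scale lowered_poly.monom AU) (use monom in auto)
    then show ?case by (simp add: clinear_scale[OF A] ac_simps)
  next
    case (lower s d g b')
    have "?G (Suc s) (Suc d) (\<lambda>m. F m b' (A b (g m) + (of_nat m * c b) *\<^sub>C g m) + (- 2) *\<^sub>C F m (b * b') (g m))"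
      by (intro lowered_poly.add lowered_poly.scale lowered_poly.lower lower.IH lowered_poly_mono[OF lower.hyps]) simp
    then show ?case
      by (simp add: AF clinear_add[OF F] clinear_scale[OF F] algebra_simps)
  qed
  have G_E: "if s = 0 then (\<forall>m. E m (g m) = 0) else ?G (s - 1) (Suc d) (\<lambda>m. E m (g m))" if "?G s d g" for s d g
    using that
  proof (induction rule: lowered_poly.induct)
    case (zero s d)
    show ?case by (simp add: clinear_0[OF E] lowered_poly.zero)
  next
    case (add s d g g')
    then show ?case using lowered_poly.add[of F U "s - 1" "Suc d" "\<lambda>m. E m (g m)" "\<lambda>m. E m (g' m)"]
      by (simp add: clinear_add[OF E] split: if_splits)
  next
    case (scale s d g k)
    then show ?case using lowered_poly.scale[of F U "s - 1" "Suc d" "\<lambda>m. E m (g m)" k]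
      by (simp add: clinear_scale[OF E] split: if_splits)
  next
    case (monom u j d)
    then show ?case by (simp add: clinear_scale[OF E] EU)
  next
    case (lower s d g b)
    have "?G s (Suc d) (\<lambda>m. F m b (E m (g m)))"
    proof (cases s)
      case 0
      then show ?thesis using lower.IH by (simp add: clinear_0[OF F] lowered_poly.zero)
    next
      case (Suc s')
      then show ?thesis using lower.IH lowered_poly.lower[of F U s' "Suc d" "\<lambda>m. E m (g m)" b] by simp
    qed
    from lowered_poly.add[OF this G_A[OF lower.hyps, of b]] show ?case by (simp add: EF)
  qed
  have v1: "?G s 1 (\<lambda>m. (F m a ^^ s) v)" for s
  proof (induction s)
    case 0
    then show ?case using lowered_poly.monom[of v U 0 1 F] v by simp
  next
    case (Suc s)
    then show ?case using lowered_poly.lower by fastforce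
  qed
  have A1: "?G s 1 (\<lambda>m. A a ((F m a ^^ s) v))" for s
  proof (induction s)
    case 0
    then show ?case using lowered_poly.monom[of "A a v" U 0 1 F] AU v by simp
  next
    case (Suc s)
    from lowered_poly_diff[OF lowered_poly.lower[OF Suc, of a] lowered_poly.scale[OF lowered_poly.lower[OF v1]], of 2 "a * a"]
    show ?case by (simp add: AF)
  qed
  have E1: "?G s 1 (\<lambda>m. E m ((F m a ^^ Suc s) v) - (of_nat (Suc s) * of_nat m * c a) *\<^sub>C (F m a ^^ s) v)" for s
  proof (induction s)
    case 0
    then show ?case using A1[of 0] by (simp add: EF EU v clinear_0[OF F])
  next
    case (Suc s)
    have "E m ((F m a ^^ Suc (Suc s)) v) - (of_nat (Suc (Suc s)) * of_nat m * c a) *\<^sub>C (F m a ^^ Suc s) v =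
        F m a (E m ((F m a ^^ Suc s) v) - (of_nat (Suc s) * of_nat m * c a) *\<^sub>C (F m a ^^ s) v)
        + A a ((F m a ^^ Suc s) v)" for m
    proof -
      let ?w = "F m a ((F m a ^^ s) v)"
      have "E m (F m a ?w) = F m a (E m ?w) + (A a ?w + (of_nat m * c a) *\<^sub>C ?w)" by (rule EF)
      moreover have "(of_nat (Suc (Suc s)) * of_nat m * c a) *\<^sub>C ?w
          = (of_nat (Suc s) * of_nat m * c a) *\<^sub>C ?w + (of_nat m * c a) *\<^sub>C ?w"
        unfolding complex_vector.scale_left_distrib[symmetric] by (simp add: distrib_left distrib_right)
      ultimately show ?thesis by (simp add: clinear_diff[OF F] clinear_scale[OF F])
    qed
    with lowered_poly.add[OF lowered_poly.lower[OF Suc] A1[of "Suc s"]] show ?case by presburger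
  qed
  \<comment> \<open>The error term after \<open>k\<close> raisings has \<open>n - k\<close> lowering operators and degree less than \<open>k\<close>.\<close>
  have main: "k \<le> n \<Longrightarrow> \<exists>C. C \<noteq> 0 \<and> ?G (n - k) k
      (\<lambda>m. (E m ^^ k) ((F m a ^^ n) v) - (C * (of_nat m * c a) ^ k) *\<^sub>C (F m a ^^ (n - k)) v)" for k
  proof (induction k)
    case 0
    then show ?case by (intro exI[of _ 1]) (simp add: lowered_poly.zero)
  next
    case (Suc k)
    then obtain C where C: "C \<noteq> 0" and G: "?G (n - k) k
      (\<lambda>m. (E m ^^ k) ((F m a ^^ n) v) - (C * (of_nat m * c a) ^ k) *\<^sub>C (F m a ^^ (n - k)) v)" by auto
    define s where "s = n - Suc k"
    have s: "n - k = Suc s" using Suc.prems by (simp add: s_def)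
    have "?G s (Suc k) (\<lambda>m. E m ((E m ^^ k) ((F m a ^^ n) v) - (C * (of_nat m * c a) ^ k) *\<^sub>C (F m a ^^ Suc s) v))"
      using G_E[OF G] by (simp add: s)
    moreover have "?G s (Suc k) (\<lambda>m. (C * c a ^ k) *\<^sub>C of_nat m ^ k *\<^sub>C
         (E m ((F m a ^^ Suc s) v) - (of_nat (Suc s) * of_nat m * c a) *\<^sub>C (F m a ^^ s) v))"
      using lowered_poly.scale[OF lowered_poly_times_power[OF F E1[of s], of k]] by simp
    ultimately have "?G s (Suc k) (\<lambda>m. E m ((E m ^^ k) ((F m a ^^ n) v) - (C * (of_nat m * c a) ^ k) *\<^sub>C (F m a ^^ Suc s) v)
        + (C * c a ^ k) *\<^sub>C of_nat m ^ k *\<^sub>C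
         (E m ((F m a ^^ Suc s) v) - (of_nat (Suc s) * of_nat m * c a) *\<^sub>C (F m a ^^ s) v))"
      by (rule lowered_poly.add)
    moreover have eq: "E m ((E m ^^ k) ((F m a ^^ n) v) - (C * (of_nat m * c a) ^ k) *\<^sub>C (F m a ^^ Suc s) v)
        + (C * c a ^ k) *\<^sub>C of_nat m ^ k *\<^sub>C
         (E m ((F m a ^^ Suc s) v) - (of_nat (Suc s) * of_nat m * c a) *\<^sub>C (F m a ^^ s) v)
        = (E m ^^ Suc k) ((F m a ^^ n) v) - ((C * of_nat (Suc s)) * (of_nat m * c a) ^ Suc k) *\<^sub>C (F m a ^^ s) v" for m
    proof -
      have e: "C * (of_nat m * c a) ^ k = C * c a ^ k * of_nat m ^ k"
        "(C * of_nat (Suc s)) * (of_nat m * c a) ^ Suc k = C * c a ^ k * of_nat m ^ k * (of_nat (Suc s) * of_nat m * c a)"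
        by (simp_all add: power_mult_distrib algebra_simps)
      show ?thesis
        unfolding e clinear_diff[OF E] clinear_scale[OF E] complex_vector.scale_right_diff_distrib complex_vector.scale_scale
        by simp
    qed
    ultimately have "?G s (Suc k) (\<lambda>m. (E m ^^ Suc k) ((F m a ^^ n) v)
        - ((C * of_nat (Suc s)) * (of_nat m * c a) ^ Suc k) *\<^sub>C (F m a ^^ s) v)"
      by (simp only: eq)
    moreover have "C * of_nat (Suc s) \<noteq> 0" using C of_nat_neq_0[of s, where 'a = complex] by (simp del: of_nat_Suc)
    ultimately show ?case unfolding s_def by blast
  qed
  obtain C where C: "C \<noteq> 0" and "?G 0 n (\<lambda>m. (E m ^^ n) ((F m a ^^ n) v) - (C * (of_nat m * c a) ^ n) *\<^sub>C v)"
    using main[OF order_refl] by auto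
  then obtain w where w: "(E m ^^ n) ((F m a ^^ n) v) - (C * (of_nat m * c a) ^ n) *\<^sub>C v = (\<Sum>j<n. of_nat m ^ j *\<^sub>C w j)" for m
    using lowered_poly_0E by blast
  define w' where "w' j = (if j = n then (C * c a ^ n) *\<^sub>C v else w j)" for j
  have "(\<Sum>j\<le>n. of_nat m ^ j *\<^sub>C w' j) = 0" for m
  proof -
    have e: "of_nat m ^ n * (C * c a ^ n) = C * (of_nat m * c a) ^ n"
      by (simp add: power_mult_distrib)
    have "(\<Sum>j\<le>n. of_nat m ^ j *\<^sub>C w' j) = (\<Sum>j<n. of_nat m ^ j *\<^sub>C w j) + of_nat m ^ n *\<^sub>C (C * c a ^ n) *\<^sub>C v"
      by (simp add: lessThan_Suc_atMost[symmetric] w'_def)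
    also have "\<dots> = 0"
      unfolding w[symmetric] nil clinear_0[OF clinear_funpow[OF E]] complex_vector.scale_scale e by simp
    finally show ?thesis .
  qed
  then have "w' n = 0" by (rule vanishing_polynomial_top_coeff)
  then show ?thesis using C v by (simp add: w'_def)
qed


section \<open>Integrable modules\<close>

lemma clinear_loop_elt: "clinear (\<lambda>x. loop_elt x k b)"
proof (rule clinearI)
  show "loop_elt (x + y) k b = loop_elt x k b + loop_elt y k b" for x y
    using tensor_add(2)[of "(x \<otimes> lmonom k, 0)" "(y \<otimes> lmonom k, 0)" b] by (simp add: loop_elt_def tensor_add)
  show "loop_elt (c *\<^sub>C x) k b = c *\<^sub>C loop_elt x k b" for c x
    using tensor_scale(2)[of c "(x \<otimes> lmonom k, 0)" b] by (simp add: loop_elt_def tensor_scale scaleC_Pair)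
qed

locale integrable_toroidal_module =
  fixes br :: "'g::complex_vector \<Rightarrow> 'g \<Rightarrow> 'g"
    and form :: "'g \<Rightarrow> 'g \<Rightarrow> complex"
    and h :: "'g set"
    and \<rho> :: "('g, 'n::finite, 'b::complex_comm_algebra) tau \<Rightarrow> 'v::complex_vector \<Rightarrow> 'v"
  assumes simple: "simple_lie_algebra br"
    and fin: "finite_dimensional (UNIV :: 'g set)"
    and cartan: "cartan_subalgebra br h"
    and form: "normalized_invariant_form br h form"
    and module: "lie_module (tau_bracket br form) \<rho>"
    and integrable: "integrable_module br h \<rho>"
begin

definition act :: "'g \<Rightarrow> 'n exponent \<Rightarrow> 'b \<Rightarrow> 'v \<Rightarrow> 'v"
  where "act x k b = \<rho> (loop_elt x k b)"

lemma bilinear_br: "cbilinear br"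
  using simple by (simp add: simple_lie_algebra_def lie_algebra_def)

lemma bilinear_form: "cbilinear form"
  using form by (simp add: normalized_invariant_form_def)

lemmas br_linear = cbilinearD[OF bilinear_br]
lemmas form_linear = cbilinearD[OF bilinear_form]

lemma br_self: "br x x = 0"
  using simple by (simp add: simple_lie_algebra_def lie_algebra_def)

lemma br_skew: "br x y = - br y x"
proof -
  have "br (x + y) (x + y) = br x y + br y x"
    unfolding clinear_add[OF br_linear(1)] clinear_add[OF br_linear(2)] by (simp add: br_self)
  then show ?thesis by (simp add: br_self eq_neg_iff_add_eq_0)
qed

lemma br_derivation: "br z (br x y) = br (br z x) y + br x (br z y)"
proof -
  have j: "br z (br x y) + br x (br y z) + br y (br z x) = 0"
    using simple by (simp add: simple_lie_algebra_def lie_algebra_def)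
  have "br x (br y z) = - br x (br z y)"
    by (subst br_skew[of y z]) (use clinear_scale[OF br_linear(1), of x "-1" "br z y"] in simp)
  moreover have "br y (br z x) = - br (br z x) y" by (rule br_skew)
  ultimately show ?thesis using j by (simp add: algebra_simps)
qed

lemma form_invariant: "form (br x y) z = form x (br y z)"
  and form_nondegenerate: "(\<And>y. form x y = 0) \<Longrightarrow> x = 0"
  using form by (auto simp: normalized_invariant_form_def)

lemma rho_linear: "clinear (\<rho> X)" "clinear (\<lambda>X. \<rho> X v)"
  using module by (simp_all only: lie_module_def cbilinear_def)

lemma rho_bracket: "\<rho> X (\<rho> Y v) = \<rho> Y (\<rho> X v) + \<rho> (tau_bracket br form X Y) v"
proof -
  have "\<rho> (tau_bracket br form X Y) v = \<rho> X (\<rho> Y v) - \<rho> Y (\<rho> X v)"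
    using module by (simp only: lie_module_def)
  then show ?thesis by simp
qed

lemma act_linear: "clinear (act x k b)" "clinear (\<lambda>x. act x k b v)"
  unfolding act_def by (rule rho_linear) (rule clinear_compose[OF rho_linear(2) clinear_loop_elt])

lemma act_act:
  "act x k b (act y r b' v) = act y r b' (act x k b v) + (act (br x y) (k + r) (b * b') v
     + (form x y) *\<^sub>C (\<Sum>j\<in>UNIV. of_int (k $ j) *\<^sub>C \<rho> (K_elt (k + r) j (b * b')) v))"
  unfolding act_def rho_bracket[of "loop_elt x k b" "loop_elt y r b'"] bracket_loop_loop[OF bilinear_br bilinear_form]
  by (simp only: clinear_add[OF rho_linear(2)] clinear_scale[OF rho_linear(2)] clinear_sum[OF rho_linear(2)])

lemma act0_act:
  "act x 0 b (act y r b' v) = act y r b' (act x 0 b v) + act (br x y) r (b * b') v"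
proof -
  have "(\<Sum>j\<in>UNIV. of_int ((0 :: 'n exponent) $ j) *\<^sub>C \<rho> (K_elt (0 + r) j (b * b')) v) = 0"
    by (rule sum.neutral) simp
  then show ?thesis
    unfolding act_act[of x 0 b] by (simp only: complex_vector.scale_zero_right add_0_left add_0_right)
qed

lemma act_act_axis:
  "act x (axis j m) b (act y (axis j (- m)) b' v) = act y (axis j (- m)) b' (act x (axis j m) b v)
     + (act (br x y) 0 (b * b') v + (form x y * of_int m) *\<^sub>C \<rho> (K_elt 0 j (b * b')) v)"
proof -
  have "axis j m + axis j (- m) = (0 :: 'n exponent)" by (simp add: vec_eq_iff axis_def)
  moreover have "(\<Sum>l\<in>UNIV. of_int ((axis j m :: 'n exponent) $ l) *\<^sub>C \<rho> (K_elt 0 l (b * b')) v)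
      = (\<Sum>l\<in>UNIV. if l = j then of_int m *\<^sub>C \<rho> (K_elt 0 j (b * b')) v else 0)"
    by (rule sum.cong) (auto simp: axis_def)
  ultimately show ?thesis
    unfolding act_act[of x "axis j m" b] by (simp only: sum.delta[OF finite] UNIV_I if_True complex_vector.scale_scale)
qed

lemma direct_sum: "is_direct_sum (dual (H_tau h)) (weight_space \<rho> (H_tau h))"
  using integrable by (simp add: integrable_module_def)

lemma act_weight_vector:
  "v \<in> weight_space \<rho> (H_tau h) \<mu> \<Longrightarrow> x \<in> h \<Longrightarrow> act x 0 1 v = \<mu> (loop_elt x 0 1) *\<^sub>C v"
  by (auto simp: weight_space_def H_tau_def act_def intro!: complex_vector.span_base)

lemma vanish_on_weight_vectors:
  assumes "clinear T" "\<And>\<mu> v. \<mu> \<in> dual (H_tau h) \<Longrightarrow> v \<in> weight_space \<rho> (H_tau h) \<mu> \<Longrightarrow> T v = 0"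
  shows "T v = 0"
proof -
  obtain f where "\<forall>i\<in>dual (H_tau h). f i \<in> weight_space \<rho> (H_tau h) i" "\<forall>i. i \<notin> dual (H_tau h) \<longrightarrow> f i = 0"
    and v: "v = (\<Sum>i\<in>{i. f i \<noteq> 0}. f i)"
    using direct_sum unfolding is_direct_sum_def by blast
  then have "T (f i) = 0" for i using assms(2) clinear_0[OF assms(1)] by metis
  then show ?thesis unfolding v clinear_sum[OF assms(1)] by simp
qed

text \<open>The operator \<open>y - a\<close> multiplies each weight component of \<open>v\<close> by a scalar \<open>s\<close>. If applying it twice
  gives zero, then by uniqueness of the decomposition \<open>s\<^sup>2\<close>, hence already \<open>s\<close>, annihilates each
  component.\<close>

lemma cartan_semisimple:
  assumes y: "y \<in> h" and v: "act y 0 1 (act y 0 1 v - a *\<^sub>C v) = a *\<^sub>C (act y 0 1 v - a *\<^sub>C v)"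
  shows "act y 0 1 v = a *\<^sub>C v"
proof -
  let ?T = "act y 0 1" and ?D = "dual (H_tau h)" and ?V = "weight_space \<rho> (H_tau h)"
  obtain f where f: "\<And>i. i \<in> ?D \<Longrightarrow> f i \<in> ?V i" "\<And>i. i \<notin> ?D \<Longrightarrow> f i = 0" "finite {i. f i \<noteq> 0}"
    and vf: "v = (\<Sum>i\<in>{i. f i \<noteq> 0}. f i)"
    using direct_sum unfolding is_direct_sum_def by blast
  define s where "s i = i (loop_elt y 0 1) - a" for i :: "('g, 'n, 'b) tau \<Rightarrow> complex"
  have Tf: "?T (f i) - a *\<^sub>C f i = s i *\<^sub>C f i" for i
    using f(1,2)[of i] act_weight_vector[OF _ y, of "f i" i] clinear_0[OF act_linear(1)]
    by (cases "i \<in> ?D") (auto simp: s_def complex_vector.scale_left_diff_distrib)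
  have sum1: "?T v - a *\<^sub>C v = (\<Sum>i\<in>{i. f i \<noteq> 0}. s i *\<^sub>C f i)"
    unfolding vf clinear_sum[OF act_linear(1)] complex_vector.scale_sum_right sum_subtractf[symmetric] Tf ..
  define g where "g i = (s i * s i) *\<^sub>C f i" for i
  have "?T (?T v - a *\<^sub>C v) - a *\<^sub>C (?T v - a *\<^sub>C v) = (\<Sum>i\<in>{i. f i \<noteq> 0}. s i *\<^sub>C (?T (f i) - a *\<^sub>C f i))"
    unfolding sum1 clinear_sum[OF act_linear(1)] complex_vector.scale_sum_right sum_subtractf[symmetric]
    by (rule sum.cong) (simp_all add: clinear_scale[OF act_linear(1)] complex_vector.scale_right_diff_distrib mult.commute)
  then have "0 = (\<Sum>i\<in>{i. f i \<noteq> 0}. g i)"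
    using v by (simp add: Tf g_def)
  also have "\<dots> = (\<Sum>i\<in>{i. g i \<noteq> 0}. g i)"
    by (rule sum.mono_neutral_right) (use f(3) in \<open>auto simp: g_def\<close>)
  finally have g0: "0 = (\<Sum>i\<in>{i. g i \<noteq> 0}. g i)" .
  let ?P = "\<lambda>w f. (\<forall>i\<in>?D. f i \<in> ?V i) \<and> (\<forall>i. i \<notin> ?D \<longrightarrow> f i = 0) \<and> finite {i. f i \<noteq> 0} \<and> w = (\<Sum>i\<in>{i. f i \<noteq> 0}. f i)"
  have sub: "complex_vector.subspace (?V i)" if "i \<in> ?D" for i
    using direct_sum that by (simp add: is_direct_sum_def)
  have g: "?P 0 g"
  proof (intro conjI ballI allI impI g0)
    show "g i \<in> ?V i" if "i \<in> ?D" for i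
      using complex_vector.subspace_scale[OF sub[OF that] f(1)[OF that]] by (simp add: g_def)
    show "g i = 0" if "i \<notin> ?D" for i using f(2)[OF that] by (simp add: g_def)
    show "finite {i. g i \<noteq> 0}" by (rule finite_subset[OF _ f(3)]) (auto simp: g_def)
  qed
  have z: "?P 0 (\<lambda>_. 0)" using complex_vector.subspace_0[OF sub] by auto
  have ex1: "\<exists>!f. ?P 0 f" using direct_sum unfolding is_direct_sum_def by (elim conjE) (erule spec)
  have "g = (\<lambda>_. 0)" by (rule trans[OF the1_equality[where P = "?P 0", OF ex1 g, symmetric] the1_equality[where P = "?P 0", OF ex1 z]])
  then have "g i = 0" for i by simp
  then have sf: "s i *\<^sub>C f i = 0" for i by (auto simp: g_def)
  have "?T v - a *\<^sub>C v = 0" unfolding sum1 by (intro sum.neutral ballI sf)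
  then show ?thesis by simp
qed

lemma act_locally_nilpotent:
  "\<alpha> \<in> roots br h \<Longrightarrow> x \<in> root_space br h \<alpha> \<Longrightarrow> locally_nilpotent (act x k b)"
  using integrable by (auto simp: integrable_module_def locally_nilpotent_def act_def)

text \<open>The central term in \<open>[x \<otimes> t\<^sup>m, y \<otimes> t\<^sup>-\<^sup>m]\<close> is a multiple of \<open>m K\<close>, so the relations hold for all \<open>m\<close> as soon
  as \<open>K\<close> acts by zero.\<close>

lemma string_relations_cartan:
  assumes x: "x \<in> root_space br h \<alpha>" and y: "y \<in> root_space br h (\<lambda>z. - \<alpha> z)"
    and z: "br x y = z" "z \<in> h" and K: "\<And>v. of_int m *\<^sub>C \<rho> (K_elt 0 j 1) v = 0"
  shows "string_relations (\<alpha> z) (act x (axis j m) 1) (act y (axis j (- m)) 1) (act z 0 1)"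
proof -
  have b: "br z x = \<alpha> z *\<^sub>C x" "br z y = (- \<alpha> z) *\<^sub>C y" using x y z(2) by (simp_all add: root_space_def)
  have "(form x y * of_int m) *\<^sub>C \<rho> (K_elt 0 j 1) v = 0" for v
    using K[of v] by (simp flip: complex_vector.scale_scale)
  then show ?thesis
    unfolding string_relations_def
    by (simp add: act_linear act_act_axis z(1) act0_act[of z _ x] act0_act[of z _ y] b clinear_scale[OF act_linear(2)]
        clinear_neg[OF act_linear(1)] clinear_neg[OF act_linear(2)])
qed

lemma trivial_or_faithful:
  "(\<forall>x v. act x 0 1 v = 0) \<or> (\<forall>x. (\<forall>v. act x 0 1 v = 0) \<longrightarrow> x = 0)"
proof -
  let ?I = "{x. \<forall>v. act x 0 1 v = 0}"
  have "lie_ideal br ?I"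
    unfolding lie_ideal_def
  proof (intro conjI allI ballI)
    show "complex_vector.subspace ?I"
      by (simp add: complex_vector.subspace_def clinear_0[OF act_linear(2)] clinear_add[OF act_linear(2)]
          clinear_scale[OF act_linear(2)])
    show "br x y \<in> ?I" if "y \<in> ?I" for x y
      using that act0_act[of x 1 y 0 1] by (simp add: clinear_0[OF act_linear(1)])
  qed
  then show ?thesis using simple unfolding simple_lie_algebra_def by blast
qed

text \<open>As \<open>g = [g, g]\<close>, the loops \<open>[x, y] \<otimes> t\<^sup>k \<otimes> b = [x, y \<otimes> t\<^sup>k \<otimes> b]\<close> act by zero, and a nonzero multiple of
  \<open>K \<otimes> b\<close> differs only by a loop from a commutator of \<open>x \<otimes> t\<close> and \<open>y \<otimes> t\<^sup>-\<^sup>1\<close> with \<open>(x, y) \<noteq> 0\<close>.\<close>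

lemma trivial_action_central:
  assumes triv: "\<And>x v. act x 0 1 v = 0"
  shows "\<rho> (K_elt 0 j b) v = 0"
proof -
  let ?S = "{br x y |x y. True}"
  have mem: "br x y \<in> complex_vector.span ?S" for x y by (rule complex_vector.span_base) blast
  have "lie_ideal br (complex_vector.span ?S)"
    unfolding lie_ideal_def using mem by simp
  moreover have "complex_vector.span ?S \<noteq> {0}"
  proof
    assume *: "complex_vector.span ?S = {0}"
    then have "br x y = 0" for x y using mem by blast
    then show False using simple by (auto simp: simple_lie_algebra_def)
  qed
  ultimately have S: "complex_vector.span ?S = UNIV"
    using simple unfolding simple_lie_algebra_def by blast
  have zero: "act z k b v = 0" for z k b v
  proof -
    have "z \<in> complex_vector.span ?S" unfolding S by (rule UNIV_I)
    then show ?thesis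
    proof (induction z rule: complex_vector.span_induct)
      case base
      show ?case
        by (simp add: complex_vector.subspace_def clinear_0[OF act_linear(2)] clinear_add[OF act_linear(2)]
            clinear_scale[OF act_linear(2)])
    next
      case (step z)
      then obtain x y where "z = br x y" by auto
      then show ?case using act0_act[of x 1 y k b v] by (simp add: triv clinear_0[OF act_linear(1)])
    qed
  qed
  obtain x y where "br x y \<noteq> 0" using simple by (auto simp: simple_lie_algebra_def)
  then obtain z where "form (br x y) z \<noteq> 0" using form_nondegenerate by blast
  moreover have "form (br x y) z *\<^sub>C \<rho> (K_elt 0 j b) v = 0"
    using act_act_axis[of "br x y" j 1 b z 1 v] by (simp add: zero)
  ultimately show ?thesis by simp
qed

section \<open>Root vectors from a faithful action\<close>

context
  assumes faithful: "\<And>x. (\<And>v. act x 0 1 v = 0) \<Longrightarrow> x = 0"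
begin

lemma cartan_abelian:
  assumes "x \<in> h" "y \<in> h"
  shows "br x y = 0"
proof (rule faithful)
  fix v
  show "act (br x y) 0 1 v = 0"
  proof (rule vanish_on_weight_vectors[OF act_linear(1)])
    fix \<mu> v assume "v \<in> weight_space \<rho> (H_tau h) \<mu>"
    then show "act (br x y) 0 1 v = 0"
      using act0_act[of x 1 y 0 1 v] act_weight_vector[OF _ assms(1)] act_weight_vector[OF _ assms(2)]
      by (simp add: clinear_scale[OF act_linear(1)] mult.commute)
  qed
qed

text \<open>If \<open>x'\<close> measures the failure of \<open>x\<close> to be an eigenvector of \<open>ad y\<close>, then on a weight vector \<open>v\<close> the
  vector \<open>x v\<close> is a generalized eigenvector of \<open>y\<close> with defect \<open>x' v\<close>. As \<open>y\<close> acts diagonalizably, \<open>x'\<close> acts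
  by zero.\<close>

lemma ad_semisimple:
  assumes y: "y \<in> h" and x: "br y (br y x - a *\<^sub>C x) = a *\<^sub>C (br y x - a *\<^sub>C x)"
  shows "br y x = a *\<^sub>C x"
proof -
  define x' where "x' = br y x - a *\<^sub>C x"
  have yx: "br y x = a *\<^sub>C x + x'" and yx': "br y x' = a *\<^sub>C x'" using x by (simp_all add: x'_def)
  have "act x' 0 1 v = 0" for v
  proof (rule vanish_on_weight_vectors[OF act_linear(1)])
    fix \<mu> v assume "v \<in> weight_space \<rho> (H_tau h) \<mu>"
    then have v: "act y 0 1 v = \<mu> (loop_elt y 0 1) *\<^sub>C v" by (rule act_weight_vector[OF _ y])
    define s where "s = \<mu> (loop_elt y 0 1)"
    have "act y 0 1 (act x 0 1 v) = (s + a) *\<^sub>C act x 0 1 v + act x' 0 1 v"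
      by (simp add: act0_act[of y 1 x 0 1 v] yx v s_def clinear_scale[OF act_linear(1)] clinear_add[OF act_linear(2)]
          clinear_scale[OF act_linear(2)] complex_vector.scale_left_distrib)
    then have e: "act x' 0 1 v = act y 0 1 (act x 0 1 v) - (s + a) *\<^sub>C act x 0 1 v" by simp
    have "act y 0 1 (act x' 0 1 v) = (s + a) *\<^sub>C act x' 0 1 v"
      by (simp add: act0_act[of y 1 x' 0 1 v] yx' v s_def clinear_scale[OF act_linear(1)]
          clinear_scale[OF act_linear(2)] complex_vector.scale_left_distrib)
    then show "act x' 0 1 v = 0"
      using cartan_semisimple[OF y, of "act x 0 1 v" "s + a"] unfolding e by simp
  qed
  then have "x' = 0" by (rule faithful)
  then show ?thesis by (simp add: x'_def)
qed

lemma root_decomposition: "complex_vector.span (\<Union>\<alpha>\<in>dual h. root_space br h \<alpha>) = UNIV"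
proof -
  obtain S :: "'g set" where S: "finite S" "complex_vector.span S = UNIV"
    using fin by (auto simp: finite_dimensional_def)
  obtain B where B: "B \<subseteq> h" "complex_vector.independent B" "h \<subseteq> complex_vector.span B"
    using complex_vector.basis_exists[of h] by metis
  have "B \<subseteq> complex_vector.span S" by (simp add: S(2))
  then have "finite B" using complex_vector.independent_span_bound[OF S(1) B(2)] by blast
  then have "complex_vector.span {x. \<forall>T\<in>br ` B. \<exists>a. T x = a *\<^sub>C x} = UNIV"
  proof (intro span_joint_eigenvectors[OF _ S])
    show "clinear T" if "T \<in> br ` B" for T using that br_linear by auto
    show "T (T' x) = T' (T x)" if "T \<in> br ` B" "T' \<in> br ` B" for T T' x
    proof -
      obtain y z where yz: "T = br y" "T' = br z" "y \<in> h" "z \<in> h" using \<open>T \<in> br ` B\<close> \<open>T' \<in> br ` B\<close> B(1) by blast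
      then show ?thesis
        using br_derivation[of y z x] cartan_abelian[OF yz(3,4)] by (simp add: clinear_0[OF br_linear(2)])
    qed
    show "T x = a *\<^sub>C x" if T: "T \<in> br ` B" and e: "T (T x - a *\<^sub>C x) = a *\<^sub>C (T x - a *\<^sub>C x)" for T x a
    proof -
      obtain y where "T = br y" "y \<in> h" using T B(1) by blast
      then show ?thesis using ad_semisimple[of y x a] e by simp
    qed
  qed simp
  moreover have "{x. \<forall>T\<in>br ` B. \<exists>a. T x = a *\<^sub>C x} \<subseteq> (\<Union>\<alpha>\<in>dual h. root_space br h \<alpha>)"
  proof
    fix x assume x: "x \<in> {x. \<forall>T\<in>br ` B. \<exists>a. T x = a *\<^sub>C x}"
    show "x \<in> (\<Union>\<alpha>\<in>dual h. root_space br h \<alpha>)"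
    proof (cases "x = 0")
      case True
      have "(\<lambda>_. 0) \<in> dual h" by (simp add: dual_def)
      moreover have "x \<in> root_space br h (\<lambda>_. 0)" by (simp add: True root_space_def clinear_0[OF br_linear(1)])
      ultimately show ?thesis by blast
    next
      case False
      have ex: "\<exists>a. br y x = a *\<^sub>C x" if "y \<in> h" for y
      proof -
        have "y \<in> complex_vector.span B" using that B(3) by blast
        then show ?thesis
        proof (induction y rule: complex_vector.span_induct)
          case base
          have "\<exists>a. br 0 x = a *\<^sub>C x" by (rule exI[of _ 0]) (simp add: clinear_0[OF br_linear(2)])
          moreover have "\<exists>a. br (y + z) x = a *\<^sub>C x" if "br y x = a *\<^sub>C x" "br z x = b *\<^sub>C x" for y z a b
            by (rule exI[of _ "a + b"]) (simp add: that clinear_add[OF br_linear(2)] complex_vector.scale_left_distrib)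
          moreover have "\<exists>a. br (c *\<^sub>C y) x = a *\<^sub>C x" if "br y x = a *\<^sub>C x" for y a c
            by (rule exI[of _ "c * a"]) (simp add: that clinear_scale[OF br_linear(2)])
          ultimately show ?case by (auto simp: complex_vector.subspace_def)
        next
          case (step y)
          then show ?case using x by blast
        qed
      qed
      define \<alpha> where "\<alpha> y = (if y \<in> h then SOME a. br y x = a *\<^sub>C x else 0)" for y
      have \<alpha>: "br y x = \<alpha> y *\<^sub>C x" if "y \<in> h" for y
        using someI_ex[OF ex[OF that]] that by (simp add: \<alpha>_def)
      have uniq: "a = b" if "a *\<^sub>C x = b *\<^sub>C x" for a b using that False by simp
      have h: "complex_vector.subspace h" using cartan by (simp add: cartan_subalgebra_def lie_subalgebra_def)
      have "\<alpha> \<in> dual h"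
        unfolding dual_def
      proof (intro CollectI conjI ballI allI impI)
        show "\<alpha> (y + z) = \<alpha> y + \<alpha> z" if "y \<in> h" "z \<in> h" for y z
          by (rule uniq) (simp add: \<alpha>[symmetric] that complex_vector.subspace_add[OF h] clinear_add[OF br_linear(2)]
              complex_vector.scale_left_distrib)
        show "\<alpha> (c *\<^sub>C y) = c * \<alpha> y" if "y \<in> h" for c y
          by (rule uniq) (simp add: \<alpha>[symmetric] that complex_vector.subspace_scale[OF h] clinear_scale[OF br_linear(2)]
              flip: complex_vector.scale_scale)
        show "\<alpha> y = 0" if "y \<notin> h" for y using that by (simp add: \<alpha>_def)
      qed
      moreover have "x \<in> root_space br h \<alpha>" using \<alpha> by (simp add: root_space_def)
      ultimately show ?thesis by blast
    qed
  qed
  ultimately show ?thesis using complex_vector.span_mono by blast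
qed

lemma commutes_with_cartan_imp_mem: "(\<And>y. y \<in> h \<Longrightarrow> br y x = 0) \<Longrightarrow> x \<in> h"
proof -
  assume *: "\<And>y. y \<in> h \<Longrightarrow> br y x = 0"
  have "0 \<in> h" using cartan by (auto simp: cartan_subalgebra_def lie_subalgebra_def complex_vector.subspace_0)
  then have "\<forall>y\<in>h. br x y \<in> h" using * by (simp add: br_skew[of x])
  then show "x \<in> h" using cartan by (auto simp: cartan_subalgebra_def)
qed

text \<open>Without roots, \<open>g\<close> would be spanned by vectors commuting with the self-normalizing \<open>h\<close>, hence equal
  to the abelian \<open>h\<close>. By invariance the form pairs a root space only with that of the opposite root,
  and it is nondegenerate.\<close>

lemma opposite_root_vectors:
  "\<exists>\<alpha> x y. \<alpha> \<in> roots br h \<and> (\<lambda>z. - \<alpha> z) \<in> roots br h \<and> x \<in> root_space br h \<alpha> \<and>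
     y \<in> root_space br h (\<lambda>z. - \<alpha> z) \<and> form x y \<noteq> 0"
proof -
  have "\<exists>\<alpha> x. \<alpha> \<in> roots br h \<and> x \<in> root_space br h \<alpha> \<and> x \<noteq> 0"
  proof (rule ccontr)
    assume *: "\<not> ?thesis"
    have h: "complex_vector.subspace h" using cartan by (simp add: cartan_subalgebra_def lie_subalgebra_def)
    have "x \<in> h" if "\<alpha> \<in> dual h" "x \<in> root_space br h \<alpha>" for \<alpha> x
    proof (cases "x = 0")
      case False
      then have "\<alpha> = (\<lambda>_. 0)" using * that by (auto simp: roots_def)
      then show ?thesis using that(2) by (intro commutes_with_cartan_imp_mem) (simp add: root_space_def)
    qed (simp add: complex_vector.subspace_0[OF h])
    then have "complex_vector.span (\<Union>\<alpha>\<in>dual h. root_space br h \<alpha>) \<subseteq> h"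
      by (intro complex_vector.span_minimal h) auto
    then have "h = UNIV" using root_decomposition by auto
    then show False using simple cartan_abelian by (auto simp: simple_lie_algebra_def)
  qed
  then obtain \<alpha> x where \<alpha>: "\<alpha> \<in> roots br h" and x: "x \<in> root_space br h \<alpha>" "x \<noteq> 0" by blast
  have "\<exists>\<beta>\<in>dual h. \<exists>y\<in>root_space br h \<beta>. form x y \<noteq> 0"
  proof (rule ccontr)
    assume *: "\<not> ?thesis"
    have "form x y = 0" for y
    proof -
      have "y \<in> complex_vector.span (\<Union>\<alpha>\<in>dual h. root_space br h \<alpha>)" by (simp add: root_decomposition)
      then show ?thesis
        by (induction y rule: complex_vector.span_induct)
          (use * in \<open>auto simp: complex_vector.subspace_def clinear_0[OF form_linear(1)]
            clinear_add[OF form_linear(1)] clinear_scale[OF form_linear(1)]\<close>)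
    qed
    then show False using form_nondegenerate x(2) by blast
  qed
  then obtain \<beta> y where \<beta>: "\<beta> \<in> dual h" and y: "y \<in> root_space br h \<beta>" "form x y \<noteq> 0" by blast
  have "\<beta> z = - \<alpha> z" for z
  proof (cases "z \<in> h")
    case True
    have "form (br x z) y = form x (br z y)" by (rule form_invariant)
    moreover have "br x z = (- \<alpha> z) *\<^sub>C x" using x(1) True by (simp add: br_skew[of x z] root_space_def)
    moreover have "br z y = \<beta> z *\<^sub>C y" using y(1) True by (simp add: root_space_def)
    ultimately have "- \<alpha> z * form x y = \<beta> z * form x y"
      using clinear_scale[OF form_linear(1)] clinear_scale[OF form_linear(2)] by (metis scaleC_complex_def)
    then have "- \<alpha> z = \<beta> z" using y(2) by (metis mult_right_cancel)
    then show ?thesis ..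
  next
    case False
    then show ?thesis using \<alpha> \<beta> by (simp add: roots_def dual_def)
  qed
  then have \<beta>eq: "\<beta> = (\<lambda>z. - \<alpha> z)" by blast
  have "y \<noteq> 0" using y(2) clinear_0[OF form_linear(1)] by auto
  then have "\<beta> \<in> roots br h"
    using \<alpha> \<beta> y(1) by (auto simp: roots_def \<beta>eq fun_eq_iff)
  then show ?thesis using \<alpha> x y by (auto simp: \<beta>eq)
qed

text \<open>The commutator \<open>z\<close> of opposite root vectors with \<open>(x, y) \<noteq> 0\<close> represents \<open>\<alpha>\<close> up to a nonzero factor. If
  \<open>\<alpha>(z) = 0\<close>, then \<open>x\<close>, \<open>y\<close>, \<open>z\<close> act as a Heisenberg algebra with locally nilpotent \<open>x\<close> and \<open>y\<close>, so \<open>z\<close> acts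
  by zero and thus \<open>z = 0\<close>, which contradicts \<open>\<alpha> \<noteq> 0\<close>.\<close>

lemma sl2_triple:
  "\<exists>\<alpha> x y z. \<alpha> \<in> roots br h \<and> (\<lambda>z. - \<alpha> z) \<in> roots br h \<and> x \<in> root_space br h \<alpha> \<and>
     y \<in> root_space br h (\<lambda>z. - \<alpha> z) \<and> form x y \<noteq> 0 \<and> br x y = z \<and> z \<in> h \<and> \<alpha> z = 2"
proof -
  obtain \<alpha> x y where \<alpha>: "\<alpha> \<in> roots br h" "(\<lambda>z. - \<alpha> z) \<in> roots br h"
    and x: "x \<in> root_space br h \<alpha>" and y: "y \<in> root_space br h (\<lambda>z. - \<alpha> z)" and xy: "form x y \<noteq> 0"
    using opposite_root_vectors by blast
  define z where "z = br x y"
  have z: "z \<in> h"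
  proof (rule commutes_with_cartan_imp_mem)
    fix w assume "w \<in> h"
    then have "br w x = \<alpha> w *\<^sub>C x" "br w y = (- \<alpha> w) *\<^sub>C y" using x y by (simp_all add: root_space_def)
    then show "br w z = 0"
      by (simp add: z_def br_derivation[of w] clinear_scale[OF br_linear(1)] clinear_scale[OF br_linear(2)]
          clinear_neg[OF br_linear(1)])
  qed
  have form_z: "form z w = \<alpha> w * form x y" if "w \<in> h" for w
  proof -
    have "br y w = \<alpha> w *\<^sub>C y" using y that by (simp add: br_skew[of y w] root_space_def)
    then show ?thesis by (simp add: z_def form_invariant clinear_scale[OF form_linear(1)] scaleC_complex_def)
  qed
  have "\<alpha> z \<noteq> 0"
  proof
    assume "\<alpha> z = 0"
    then have r: "string_relations 0 (act x (axis None 0) 1) (act y (axis None (- 0)) 1) (act z 0 1)"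
      using string_relations_cartan[OF x y z_def[symmetric] z, of 0 None] by simp
    have "act z 0 1 v = 0" for v
    proof (rule vanish_on_weight_vectors[OF act_linear(1)])
      fix \<mu> v assume v: "v \<in> weight_space \<rho> (H_tau h) \<mu>"
      show "act z 0 1 v = 0"
      proof (cases "v = 0")
        case False
        let ?e = "act x (axis None 0) 1"
        obtain n where n: "(?e ^^ n) v \<noteq> 0" "?e ((?e ^^ n) v) = 0"
          using last_nonzero_power[OF act_locally_nilpotent[OF \<alpha>(1) x] False] by blast
        have zv: "act z 0 1 v = \<mu> (loop_elt z 0 1) *\<^sub>C v" by (rule act_weight_vector[OF v z])
        have "\<exists>k. \<mu> (loop_elt z 0 1) + of_nat n * 0 = of_nat k * 0 / 2"
          by (rule highest_weight_values[OF r n(2) raising_string_weight[OF r zv] n(1) act_locally_nilpotent[OF \<alpha>(2) y]])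
        then show ?thesis using zv by simp
      qed (simp add: clinear_0[OF act_linear(1)])
    qed
    then have "z = 0" by (rule faithful)
    then have "\<alpha> w = 0" if "w \<in> h" for w
      using form_z[OF that] xy clinear_0[OF form_linear(2)] by simp
    moreover have "\<alpha> w = 0" if "w \<notin> h" for w using \<alpha>(1) that by (simp add: roots_def dual_def)
    ultimately have "\<alpha> = (\<lambda>_. 0)" by blast
    then show False using \<alpha>(1) by (simp add: roots_def)
  qed
  define c where "c = 2 / \<alpha> z"
  have "c \<noteq> 0" using \<open>\<alpha> z \<noteq> 0\<close> by (simp add: c_def)
  have h: "complex_vector.subspace h" using cartan by (simp add: cartan_subalgebra_def lie_subalgebra_def)
  have "c *\<^sub>C y \<in> root_space br h (\<lambda>z. - \<alpha> z)"
    using y by (simp add: root_space_def clinear_scale[OF br_linear(1)] mult.commute)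
  moreover have "form x (c *\<^sub>C y) \<noteq> 0" using xy \<open>c \<noteq> 0\<close> by (simp add: clinear_scale[OF form_linear(1)])
  moreover have "br x (c *\<^sub>C y) = c *\<^sub>C z" by (simp add: clinear_scale[OF br_linear(1)] z_def)
  moreover have "\<alpha> (c *\<^sub>C z) = 2"
    using \<alpha>(1) z \<open>\<alpha> z \<noteq> 0\<close> by (simp add: roots_def dual_def c_def)
  moreover have "c *\<^sub>C z \<in> h" by (rule complex_vector.subspace_scale[OF h z])
  ultimately show ?thesis using \<alpha> x by blast
qed

end

end


section \<open>Weights along a direction of level zero\<close>

locale level_zero_direction = integrable_toroidal_module br form h \<rho>
  for br :: "'g::complex_vector \<Rightarrow> 'g \<Rightarrow> 'g" and form h
    and \<rho> :: "('g, 'n::finite, 'b::complex_comm_algebra) tau \<Rightarrow> 'v::complex_vector \<Rightarrow> 'v" +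
  fixes \<alpha> :: "'g \<Rightarrow> complex" and e f h\<^sub>\<alpha> :: 'g and j :: "'n option"
    and \<mu> :: "('g, 'n, 'b) tau \<Rightarrow> complex" and c :: "'b \<Rightarrow> complex"
  assumes roots: "\<alpha> \<in> roots br h" "(\<lambda>z. - \<alpha> z) \<in> roots br h"
    and root_vectors: "e \<in> root_space br h \<alpha>" "f \<in> root_space br h (\<lambda>z. - \<alpha> z)"
    and form_ef: "form e f \<noteq> 0"
    and coroot: "br e f = h\<^sub>\<alpha>" "h\<^sub>\<alpha> \<in> h" "\<alpha> h\<^sub>\<alpha> = 2" "\<And>w. w \<in> h \<Longrightarrow> br w h\<^sub>\<alpha> = 0"
    and weight: "\<mu> \<in> dual (H_tau h)" "weight_space \<rho> (H_tau h) \<mu> \<noteq> {0}"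
      "finite_dimensional (weight_space \<rho> (H_tau h) \<mu>)"
    and central_scalars: "\<And>b v. \<rho> (K_elt 0 j b) v = c b *\<^sub>C v"
    and level_zero: "c 1 = 0"
begin

text \<open>The weight space for \<open>\<mu> + k \<alpha> + m \<delta>\<close>, described by the action of the generators of \<open>H\<close>; this avoids
  extending \<open>\<alpha>\<close> and \<open>\<delta>\<close> to functionals on \<open>H\<close>.\<close>

definition W :: "int \<Rightarrow> int \<Rightarrow> 'v set"
  where "W k m = {v. (\<forall>x\<in>h. act x 0 1 v = (\<mu> (loop_elt x 0 1) + of_int k * \<alpha> x) *\<^sub>C v) \<and>
     (\<forall>i. \<rho> (K_elt 0 i 1) v = \<mu> (K_elt 0 i 1) *\<^sub>C v) \<and>
     (\<forall>i. \<rho> (d_elt i) v = (\<mu> (d_elt i) + (if i = j then of_int m else 0)) *\<^sub>C v)}"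

lemma W_0_0: "W 0 0 = weight_space \<rho> (H_tau h) \<mu>"
proof (intro set_eqI iffI)
  fix v assume v: "v \<in> W 0 0"
  have dual: "\<mu> (x + y) = \<mu> x + \<mu> y" "\<mu> (a *\<^sub>C x) = a * \<mu> x" if "x \<in> H_tau h" "y \<in> H_tau h" for x y a
    using weight(1) that by (auto simp: dual_def)
  have H: "complex_vector.subspace (H_tau h :: ('g, 'n, 'b) tau set)" by (simp add: H_tau_def)
  have "x \<in> H_tau h \<and> \<rho> x v = \<mu> x *\<^sub>C v" if "x \<in> H_tau h" for x
    using that[unfolded H_tau_def]
  proof (induction x rule: complex_vector.span_induct)
    case base
    have "\<mu> 0 = 0" using dual(2)[of 0 0 0] complex_vector.subspace_0[OF H] by simp
    then show ?case
      using complex_vector.subspace_0[OF H] complex_vector.subspace_add[OF H] complex_vector.subspace_scale[OF H]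
      by (auto simp: complex_vector.subspace_def clinear_0[OF rho_linear(2)] clinear_add[OF rho_linear(2)]
          clinear_scale[OF rho_linear(2)] dual complex_vector.scale_left_distrib)
  next
    case (step x)
    then have "x \<in> H_tau h" unfolding H_tau_def by (rule complex_vector.span_base)
    with step v show ?case by (auto simp: W_def act_def)
  qed
  then show "v \<in> weight_space \<rho> (H_tau h) \<mu>" by (simp add: weight_space_def)
next
  fix v assume v: "v \<in> weight_space \<rho> (H_tau h) \<mu>"
  have "(K_elt 0 i 1 :: ('g, 'n, 'b) tau) \<in> H_tau h" "(d_elt i :: ('g, 'n, 'b) tau) \<in> H_tau h" for i
    by (auto simp: H_tau_def intro!: complex_vector.span_base)
  then show "v \<in> W 0 0" using v act_weight_vector[OF v] by (simp add: W_def weight_space_def)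
qed

lemma act_W:
  assumes x: "\<And>w. w \<in> h \<Longrightarrow> br w x = (of_int s * \<alpha> w) *\<^sub>C x" and v: "v \<in> W k m"
  shows "act x (axis j r) b v \<in> W (k + s) (m + r)"
  unfolding W_def
proof (intro CollectI conjI ballI allI)
  let ?v = "act x (axis j r) b v"
  fix w assume w: "w \<in> h"
  have "act w 0 1 v = (\<mu> (loop_elt w 0 1) + of_int k * \<alpha> w) *\<^sub>C v" using v w by (simp add: W_def)
  then show "act w 0 1 ?v = (\<mu> (loop_elt w 0 1) + of_int (k + s) * \<alpha> w) *\<^sub>C ?v"
    by (simp add: act0_act[of w 1 x] x[OF w] clinear_add[OF act_linear(1)] clinear_scale[OF act_linear(1)] clinear_scale[OF act_linear(2)]
        complex_vector.scale_left_distrib distrib_right)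
next
  let ?v = "act x (axis j r) b v"
  fix i
  have K: "\<rho> (K_elt 0 i 1) v = \<mu> (K_elt 0 i 1) *\<^sub>C v"
    and d: "\<rho> (d_elt i) v = (\<mu> (d_elt i) + (if i = j then of_int m else 0)) *\<^sub>C v" using v by (simp_all add: W_def)
  show "\<rho> (K_elt 0 i 1) ?v = \<mu> (K_elt 0 i 1) *\<^sub>C ?v"
    unfolding act_def rho_bracket[of "K_elt 0 i 1" "loop_elt x (axis j r) b" v] bracket_K(1)[OF bilinear_br bilinear_form] K
    by (simp add: clinear_scale[OF rho_linear(1)] clinear_0[OF rho_linear(2)])
  show "\<rho> (d_elt i) ?v = (\<mu> (d_elt i) + (if i = j then of_int (m + r) else 0)) *\<^sub>C ?v"
    unfolding act_def rho_bracket[of "d_elt i" "loop_elt x (axis j r) b" v] bracket_d_loop[OF bilinear_br bilinear_form] d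
    by (simp add: clinear_add[OF rho_linear(1)] clinear_scale[OF rho_linear(1)] clinear_scale[OF rho_linear(2)] axis_def
        complex_vector.scale_left_distrib)
qed

lemma e_W: "v \<in> W k m \<Longrightarrow> act e (axis j r) b v \<in> W (k + 1) (m + r)"
  and f_W: "v \<in> W k m \<Longrightarrow> act f (axis j r) b v \<in> W (k - 1) (m + r)"
  and coroot_W: "v \<in> W k m \<Longrightarrow> act h\<^sub>\<alpha> 0 b v \<in> W k m"
proof -
  have 0: "(axis j 0 :: 'n exponent) = 0" by (simp add: axis_def vec_eq_iff)
  show "v \<in> W k m \<Longrightarrow> act e (axis j r) b v \<in> W (k + 1) (m + r)"
    by (rule act_W) (use root_vectors in \<open>simp_all add: root_space_def\<close>)
  show "v \<in> W k m \<Longrightarrow> act f (axis j r) b v \<in> W (k - 1) (m + r)"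
    using act_W[of f "-1" v k m r b] root_vectors by (simp add: root_space_def)
  show "v \<in> W k m \<Longrightarrow> act h\<^sub>\<alpha> 0 b v \<in> W k m"
    using act_W[of h\<^sub>\<alpha> 0 v k m 0 b] coroot(4) by (simp add: 0)
qed

lemma e_power_W: "v \<in> W k m \<Longrightarrow> (act e (axis j r) b ^^ n) v \<in> W (k + int n) (m + int n * r)"
proof (induction n)
  case (Suc n)
  then show ?case using e_W[of "(act e (axis j r) b ^^ n) v" "k + int n" "m + int n * r" r b]
    by (simp add: algebra_simps)
qed simp

lemma f_power_W: "v \<in> W k m \<Longrightarrow> (act f (axis j r) b ^^ n) v \<in> W (k - int n) (m + int n * r)"
proof (induction n)
  case (Suc n)
  then show ?case using f_W[of "(act f (axis j r) b ^^ n) v" "k - int n" "m + int n * r" r b]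
    by (simp add: algebra_simps)
qed simp

lemma e_nilpotent: "locally_nilpotent (act e k b)"
  and f_nilpotent: "locally_nilpotent (act f k b)"
  by (rule act_locally_nilpotent[OF roots(1) root_vectors(1)] act_locally_nilpotent[OF roots(2) root_vectors(2)])+

lemma sl2_relations: "string_relations 2 (act e (axis j m) 1) (act f (axis j (- m)) 1) (act h\<^sub>\<alpha> 0 1)"
  using string_relations_cartan[OF root_vectors coroot(1,2), of m j] by (simp add: central_scalars level_zero coroot(3))

text \<open>The weight of \<open>W 0 0\<close> under the coroot, an integer by integrability.\<close>

definition base_weight :: int where "base_weight = (SOME p. \<mu> (loop_elt h\<^sub>\<alpha> 0 1) = of_int p)"

lemma coroot_weight:
  assumes "v \<in> W k m"
  shows "act h\<^sub>\<alpha> 0 1 v = of_int (base_weight + 2 * k) *\<^sub>C v"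
proof -
  have "0 \<in> weight_space \<rho> (H_tau h) \<mu>" by (simp add: weight_space_def clinear_0[OF rho_linear(1)])
  then obtain u where u: "u \<in> W 0 0" "u \<noteq> 0" unfolding W_0_0 using weight(2) by blast
  have "act h\<^sub>\<alpha> 0 1 u = \<mu> (loop_elt h\<^sub>\<alpha> 0 1) *\<^sub>C u" using u(1) coroot(2) by (simp add: W_def)
  then have "\<exists>p. \<mu> (loop_elt h\<^sub>\<alpha> 0 1) = of_int p"
    using weights_integral[OF sl2_relations e_nilpotent f_nilpotent] u(2) by blast
  then have "\<mu> (loop_elt h\<^sub>\<alpha> 0 1) = of_int base_weight" unfolding base_weight_def by (rule someI_ex)
  then show ?thesis using assms coroot(2,3) by (simp add: W_def mult.commute)
qed

lemma e_uniformly_nilpotent: "\<exists>N. \<forall>n\<ge>N. \<forall>v\<in>W 0 0. (act e (axis j 0) 1 ^^ n) v = 0"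
proof -
  let ?e = "act e (axis j 0) 1"
  obtain S where S: "finite S" "complex_vector.span S = W 0 0"
    using weight(3) by (auto simp: W_0_0 finite_dimensional_def)
  obtain n where n: "(?e ^^ n v) v = 0" for v
    using e_nilpotent[of "axis j 0" 1] unfolding locally_nilpotent_def by metis
  define N where "N = Max (insert 0 (n ` S))"
  have "(?e ^^ k) v = 0" if k: "k \<ge> N" and v: "v \<in> W 0 0" for k v
  proof -
    have l: "clinear (?e ^^ k)" for k by (rule clinear_funpow[OF act_linear(1)])
    have "v \<in> complex_vector.span S" using v S by simp
    then show ?thesis
    proof (induction v rule: complex_vector.span_induct)
      case base
      show ?case by (simp add: complex_vector.subspace_def clinear_0[OF l] clinear_add[OF l] clinear_scale[OF l])
    next
      case (step v)
      then have "n v \<le> k" using k S(1) by (auto simp: N_def)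
      then have "?e ^^ k = ?e ^^ (k - n v) \<circ> ?e ^^ n v" by (simp flip: funpow_add)
      then show ?case by (simp add: n clinear_0[OF l])
    qed
  qed
  then show ?thesis by blast
qed

text \<open>A highest weight vector \<open>u\<close> in \<open>W i 0\<close> gives the vector \<open>f\<^sup>i u\<close> in \<open>W 0 0\<close>, which \<open>e\<^sup>i\<close> does not kill. By
  uniform nilpotency \<open>i\<close> is bounded.\<close>

lemma W_bounded_degree_0: "\<exists>M\<ge>0. \<forall>k\<ge>M. W k 0 \<subseteq> {0}"
proof -
  let ?e = "act e (axis j 0) 1" and ?f = "act f (axis j 0) 1"
  have r: "string_relations 2 ?e ?f (act h\<^sub>\<alpha> 0 1)" using sl2_relations[of 0] by simp
  obtain N where N: "(?e ^^ n) v = 0" if "n \<ge> N" "v \<in> W 0 0" for n v using e_uniformly_nilpotent by blast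
  have "w = 0" if k: "k \<ge> max (int N) (- base_weight)" and w: "w \<in> W k 0" for k w
  proof (rule ccontr)
    assume "w \<noteq> 0"
    then obtain n where n: "(?e ^^ n) w \<noteq> 0" "?e ((?e ^^ n) w) = 0"
      using last_nonzero_power[OF e_nilpotent] by blast
    \<comment> \<open>The bound \<open>k \<ge> - base_weight\<close> makes the weight of \<open>u\<close> at least \<open>i\<close>, so its string reaches \<open>W 0 0\<close>.\<close>
    define i where "i = nat (k + int n)"
    have i: "k + int n = int i" using k by (simp add: i_def)
    let ?u = "(?e ^^ n) w"
    have u: "?u \<in> W (int i) 0" using e_power_W[OF w, where r = 0 and b = 1 and n = n] by (simp add: i)
    have le: "int i \<le> base_weight + 2 * int i" "i \<ge> N" using k i by auto
    then have "act h\<^sub>\<alpha> 0 1 ?u = of_nat (nat (base_weight + 2 * int i)) *\<^sub>C ?u" using coroot_weight[OF u] by simp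
    from raise_lower_power_nonzero[OF r n(2) this n(1), of i]
    have "(?e ^^ i) ((?f ^^ i) ?u) \<noteq> 0" using le by linarith
    moreover have "(?f ^^ i) ?u \<in> W 0 0" using f_power_W[OF u, where r = 0 and b = 1 and n = i] by simp
    ultimately show False using N le(2) by blast
  qed
  then show ?thesis by (intro exI[of _ "max (int N) (- base_weight)"]) auto
qed

text \<open>The operator \<open>f \<otimes> t\<^sup>-\<^sup>m\<close> maps \<open>W k m\<close> injectively into \<open>W (k - 1) 0\<close> when the weight \<open>base_weight + 2 k\<close> is
  positive.\<close>

lemma W_bounded: "\<exists>M. \<forall>k m. k > M \<longrightarrow> W k m \<subseteq> {0}"
proof -
  obtain M where M0: "M \<ge> 0" and M: "\<And>k. k \<ge> M \<Longrightarrow> W k 0 \<subseteq> {0}" using W_bounded_degree_0 by blast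
  have "w = 0" if k: "k > max M (- base_weight)" and w: "w \<in> W k m" for k m w
  proof (rule ccontr)
    assume "w \<noteq> 0"
    moreover have "base_weight + 2 * k > 0" using k M0 by simp
    ultimately have "act f (axis j (- m)) 1 w \<noteq> 0"
      using lower_positive_weight_nonzero[OF sl2_relations e_nilpotent coroot_weight[OF w]] by blast
    moreover have "act f (axis j (- m)) 1 w \<in> W (k - 1) 0" using f_W[OF w, of "- m" 1] by simp
    ultimately show False using M[of "k - 1"] k by auto
  qed
  then show ?thesis by (intro exI[of _ "max M (- base_weight)"]) auto
qed

lemma top_weight_space: "\<exists>k m v. v \<in> W k m \<and> v \<noteq> 0 \<and> (\<forall>k' m'. k' > k \<longrightarrow> W k' m' \<subseteq> {0})"
proof -
  obtain M where M: "W k m \<subseteq> {0}" if "k > M" for k m using W_bounded by blast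
  define P where "P n \<longleftrightarrow> (\<exists>m v. v \<in> W (M - int n) m \<and> v \<noteq> 0)" for n
  have "0 \<in> weight_space \<rho> (H_tau h) \<mu>" by (simp add: weight_space_def clinear_0[OF rho_linear(1)])
  then obtain u where u: "u \<in> W 0 0" "u \<noteq> 0" unfolding W_0_0 using weight(2) by blast
  then have "M \<ge> 0" using M[of 0 0] by fastforce
  then have P: "P (nat M)" using u by (auto simp: P_def)
  define n where "n = (LEAST n. P n)"
  have "P n" unfolding n_def by (rule LeastI[of P, OF P])
  then obtain m v where v: "v \<in> W (M - int n) m" "v \<noteq> 0" by (auto simp: P_def)
  have "W k m' \<subseteq> {0}" if "k > M - int n" for k m'
  proof (cases "k > M")
    case False
    then have "nat (M - k) < n" "k = M - int (nat (M - k))" using that by auto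
    then have "\<not> P (nat (M - k))" using not_less_Least n_def by blast
    then show ?thesis using \<open>k = M - int (nat (M - k))\<close> unfolding P_def by auto
  qed (use M in blast)
  then show ?thesis using v by blast
qed

text \<open>In a top weight space the reflection argument bounds the lowering exponents uniformly in \<open>m\<close>: a
  nonzero product of more than \<open>base_weight + 2 k\<close> lowering operators on \<open>v\<close> would have a reflected weight
  above the top.\<close>

lemma central_scalars_vanish: "c a = 0"
proof -
  obtain k m0 v where v: "v \<in> W k m0" "v \<noteq> 0" and top: "\<And>k' m'. k' > k \<Longrightarrow> W k' m' \<subseteq> {0}"
    using top_weight_space by blast
  define n where "n = Suc (nat (base_weight + 2 * k))"
  have nil: "(act f (axis j (- int m)) a ^^ n) v = 0" for m
  proof (rule ccontr)
    let ?u = "(act f (axis j (- int m)) a ^^ n) v"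
    assume "?u \<noteq> 0"
    have u: "?u \<in> W (k - int n) (m0 - int n * int m)" using f_power_W[OF v(1), where r = "- int m" and b = a and n = n] by simp
    let ?e = "act e (axis j 0) 1" and ?f = "act f (axis j 0) 1"
    have r: "string_relations 2 ?e ?f (act h\<^sub>\<alpha> 0 1)" using sl2_relations[of 0] by simp
    obtain i l where il: "int l = 2 * int i - (base_weight + 2 * (k - int n))" "(?e ^^ l) ((?f ^^ i) ?u) \<noteq> 0"
      using reflected_weight[OF r e_nilpotent f_nilpotent coroot_weight[OF u] \<open>?u \<noteq> 0\<close>] by blast
    have "(?e ^^ l) ((?f ^^ i) ?u) \<in> W (k - int n - int i + int l) (m0 - int n * int m)"
      using e_power_W[OF f_power_W[OF u, where r = 0 and b = 1 and n = i], where r = 0 and b = 1 and n = l] by simp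
    moreover have "k - int n - int i + int l > k"
    proof -
      have "int n > base_weight + 2 * k" by (simp add: n_def)
      moreover have "int i \<ge> 0" by simp
      ultimately show ?thesis using il(1) unfolding right_diff_distrib by linarith
    qed
    ultimately show False using top il(2) by blast
  qed
  have "form e f * c a = 0"
  proof (rule central_charge_zero[where E = "\<lambda>m. act e (axis j (int m)) 1" and F = "\<lambda>m. act f (axis j (- int m))"
        and A = "act h\<^sub>\<alpha> 0" and U = "W k m0" and c = "\<lambda>b. form e f * c b", OF _ _ _ _ _ _ _ v nil])
    show "act e (axis j (int m)) 1 (act f (axis j (- int m)) b v) = act f (axis j (- int m)) b (act e (axis j (int m)) 1 v)
        + (act h\<^sub>\<alpha> 0 b v + (of_nat m * (form e f * c b)) *\<^sub>C v)" for m b v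
      unfolding act_act_axis[of e j "int m" 1 f b v] coroot(1) central_scalars by (simp add: mult_ac)
    have tf: "br h\<^sub>\<alpha> f = (- 2) *\<^sub>C f" using root_vectors(2) coroot(2,3) by (simp add: root_space_def)
    show "act h\<^sub>\<alpha> 0 b (act f (axis j (- int m)) b' v) = act f (axis j (- int m)) b' (act h\<^sub>\<alpha> 0 b v)
        - 2 *\<^sub>C act f (axis j (- int m)) (b * b') v" for m b b' v
      unfolding act0_act[of h\<^sub>\<alpha> b f] tf clinear_scale[OF act_linear(2)] by simp
    show "act e (axis j (int m)) 1 u = 0" if "u \<in> W k m0" for m u
      using e_W[OF that, of "int m" 1] top[of "k + 1"] by auto
  qed (simp_all add: act_linear coroot_W)
  then show ?thesis using form_ef by simp
qed

end

section \<open>Reduction to scalars\<close>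

lemma irreducible_module_scalar:
  assumes irr: "irreducible_module \<rho>" and lin: "\<And>x. clinear (\<rho> x)"
    and T: "clinear T" and comm: "\<And>x v. T (\<rho> x v) = \<rho> x (T v)"
    and W: "complex_vector.subspace W" "finite_dimensional W" "W \<noteq> {0}" "\<And>v. v \<in> W \<Longrightarrow> T v \<in> W"
  shows "\<exists>a. \<forall>v. T v = a *\<^sub>C v"
proof -
  obtain S where S: "finite S" "complex_vector.span S = W" using W(2) by (auto simp: finite_dimensional_def)
  obtain x where x: "x \<in> W" "x \<notin> {0}" using W(1,3) complex_vector.subspace_0[OF W(1)] by blast
  have "W \<subseteq> complex_vector.span S" using S(2) by simp
  from eigenvector_modulo_subspace[OF T W(1,4) S(1) this complex_vector.subspace_single_0 x]
  obtain z a where z: "z \<noteq> 0" "T z = a *\<^sub>C z" by auto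
  let ?I = "{v. T v = a *\<^sub>C v}"
  have "complex_vector.subspace ?I"
    by (simp add: complex_vector.subspace_def clinear_0[OF T] clinear_add[OF T] clinear_scale[OF T]
        complex_vector.scale_right_distrib mult.commute)
  moreover have "\<rho> x v \<in> ?I" if "v \<in> ?I" for x v
    using that by (simp add: comm clinear_scale[OF lin])
  ultimately have "?I = {0} \<or> ?I = UNIV" using irr unfolding irreducible_module_def by blast
  then have "?I = UNIV" using z by blast
  then show ?thesis by blast
qed

context integrable_toroidal_module
begin

lemma rho_K_commutes: "\<rho> (K_elt 0 i b) (\<rho> X v) = \<rho> X (\<rho> (K_elt 0 i b) v)"
proof -
  have "tau_bracket br form (K_elt 0 i b) X = 0"
  proof (rule tau_generators[where f = "tau_bracket br form (K_elt 0 i b)"])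
    show "clinear (tau_bracket br form (K_elt 0 i b))"
      by (rule cbilinearD(1)[OF cbilinear_tau_bracket[OF bilinear_br bilinear_form]])
    show "tau_bracket br form (K_elt 0 i b) (d_elt l) = 0" for l
      using bracket_d_K[OF bilinear_br bilinear_form, of l 0 i b]
      by (simp add: K_elt_def bracket_d[OF bilinear_br bilinear_form])
  qed (simp_all add: bracket_K[OF bilinear_br bilinear_form])
  then show ?thesis using rho_bracket[of "K_elt 0 i b" X v] by (simp add: clinear_0[OF rho_linear(2)])
qed

lemma level_zero_direction_trivial:
  assumes irr: "irreducible_module \<rho>"
    and fd: "\<And>\<mu>. \<mu> \<in> dual (H_tau h) \<Longrightarrow> finite_dimensional (weight_space \<rho> (H_tau h) \<mu>)"
    and zero: "\<And>v. \<rho> (K_elt 0 j 1) v = 0"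
  shows "\<rho> (K_elt 0 j b) v = 0"
proof (cases "\<forall>x v. act x 0 1 v = 0")
  case True
  then show ?thesis by (intro trivial_action_central) blast
next
  case False
  then have faithful: "\<And>x. (\<And>v. act x 0 1 v = 0) \<Longrightarrow> x = 0" using trivial_or_faithful by blast
  obtain u :: 'v where u: "u \<noteq> 0" using irr by (auto simp: irreducible_module_def)
  have "\<exists>\<mu>\<in>dual (H_tau h). weight_space \<rho> (H_tau h) \<mu> \<noteq> {0}"
  proof (rule ccontr)
    assume *: "\<not> ?thesis"
    have "clinear (\<lambda>v :: 'v. v)" by (rule clinearI) simp_all
    then have "u = 0" by (rule vanish_on_weight_vectors) (use * in blast)
    then show False using u by simp
  qed
  then obtain \<mu> where \<mu>: "\<mu> \<in> dual (H_tau h)" "weight_space \<rho> (H_tau h) \<mu> \<noteq> {0}" by blast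
  have V: "complex_vector.subspace (weight_space \<rho> (H_tau h) \<mu>)"
    using direct_sum \<mu>(1) by (simp add: is_direct_sum_def)
  have "\<exists>a. \<forall>v. \<rho> (K_elt 0 j b) v = a *\<^sub>C v" for b
  proof (rule irreducible_module_scalar[where \<rho> = \<rho> and T = "\<rho> (K_elt 0 j b)" and W = "weight_space \<rho> (H_tau h) \<mu>"])
    show "\<rho> (K_elt 0 j b) (\<rho> x v) = \<rho> x (\<rho> (K_elt 0 j b) v)" for x v by (rule rho_K_commutes)
    show "\<rho> (K_elt 0 j b) v \<in> weight_space \<rho> (H_tau h) \<mu>" if "v \<in> weight_space \<rho> (H_tau h) \<mu>" for v
      using that by (simp add: weight_space_def clinear_scale[OF rho_linear(1)] flip: rho_K_commutes)
  qed (fact irr rho_linear(1) V fd[OF \<mu>(1)] \<mu>(2))+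
  then obtain c where c: "\<rho> (K_elt 0 j b) v = c b *\<^sub>C v" for b v by metis
  have "c 1 = 0" using zero[of u] u by (simp add: c)
  obtain \<alpha> x y z where sl2: "\<alpha> \<in> roots br h" "(\<lambda>z. - \<alpha> z) \<in> roots br h" "x \<in> root_space br h \<alpha>"
     "y \<in> root_space br h (\<lambda>z. - \<alpha> z)" "form x y \<noteq> 0" "br x y = z" "z \<in> h" "\<alpha> z = 2"
    using sl2_triple[OF faithful] by blast
  interpret level_zero_direction br form h \<rho> \<alpha> x y z j \<mu> c
  proof unfold_locales
    show "br w z = 0" if "w \<in> h" for w by (rule cartan_abelian[OF faithful that sl2(7)])
    show "finite_dimensional (weight_space \<rho> (H_tau h) \<mu>)" by (rule fd[OF \<mu>(1)])
    show "\<rho> (K_elt 0 j b) v = c b *\<^sub>C v" for b v by (rule c)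
  qed (fact sl2 \<mu> \<open>c 1 = 0\<close>)+
  show ?thesis by (simp add: c central_scalars_vanish)
qed

end

theorem proposition4p3:
  fixes br :: "'g::complex_vector \<Rightarrow> 'g \<Rightarrow> 'g"
    and form :: "'g \<Rightarrow> 'g \<Rightarrow> complex"
    and h :: "'g set"
    and \<rho> :: "('g, 'n::finite, 'b::complex_comm_algebra) tau \<Rightarrow> 'v::complex_vector \<Rightarrow> 'v"
    and c0 :: int
  assumes "simple_lie_algebra br"
    and "finite_dimensional (UNIV :: 'g set)"
    and "cartan_subalgebra br h"
    and "normalized_invariant_form br h form"
    and "finitely_generated_algebra TYPE('b)"
    and "lie_module (tau_bracket br form) \<rho>"
    and "irreducible_module \<rho>"
    and "integrable_module br h \<rho>"
    and "\<forall>\<mu>\<in>dual (H_tau h). finite_dimensional (weight_space \<rho> (H_tau h) \<mu>)"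
    and "c0 > 0"
    and "\<forall>v. \<rho> (K_elt 0 None 1) v = of_int c0 *\<^sub>C v"
    and "\<forall>(i::'n) v. \<rho> (K_elt 0 (Some i) 1) v = 0"
  shows "\<forall>(i::'n) (b::'b) v. \<rho> (K_elt 0 (Some i) b) v = 0"
proof -
  interpret integrable_toroidal_module br form h \<rho>
    by unfold_locales (fact assms)+
  show ?thesis
  proof (intro allI, rule level_zero_direction_trivial)
    show "irreducible_module \<rho>" by (fact assms(7))
    show "finite_dimensional (weight_space \<rho> (H_tau h) \<mu>)" if "\<mu> \<in> dual (H_tau h)" for \<mu>
      by (rule bspec[OF assms(9) that])
    show "\<rho> (K_elt 0 (Some i) 1) v = 0" for i v
      by (rule assms(12)[rule_format])
  qed
qed

end
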